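(* Let $F$ be a bounded, compact and full-dimensional subset of the elliptic plane. Among all conics with given center that contain $F$ there exists exactly one of minimal area.
   Context: The elliptic plane is the unit sphere $S^2\subset\mathbb{R}^3$ with antipodal points identified; its lines are the images of great circles (intersections of $S^2$ with two-dimensional linear subspaces), and area is inherited from $S^2$ (the whole elliptic plane has area $2\pi$). A conic is a set $C=\{x\in S^2 : x^{T}Mx=0\}$ where $M\in\mathbb{R}^{3\times 3}$ is symmetric, invertible and indefinite, scaled so that it has eigenvalues $\nu_1\ge\nu_2>0$ and $\nu_3=-1$. Its interior is $\{x\in S^2 : x^{T}Mx<0\}$. A conic $C$ contains (encloses) a set $F$ if $x^{T}Mx\le 0$ for all $x\in F$. The center of $C$ is the point spanned by an eigenvector for the eigenvalue $-1$. The area of $C$ is the area of its interior in the elliptic plane, namely $$2\pi-\int_{-\pi}^{\pi}\sqrt{\frac{\nu_1\sin^2\varphi+\nu_2\cos^2\varphi}{1+\nu_1\sin^2\varphi+\nu_2\cos^2\varphi}}\,d\varphi .$$ A subset of the elliptic plane is called bounded if it is contained in a circle (a conic with $\nu_1=\nu_2$), and full-dimensional if it is not contained in a line.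
   Formalization: The formal theorem additionally assumes that at least one conic with the given center contains F; without this the claim is false, e.g. when F meets the polar line of the given center. *)

theory Defs
  imports "HOL-Analysis.Analysis"
begin

quotient_type elliptic_plane =
  "real^3" / partial: "\<lambda>x y. norm x = 1 \<and> (y = x \<or> y = - x)"
  morphisms rep_elliptic point_of
proof (rule part_equivpI)
  show "\<exists>x::real^3. norm x = 1 \<and> (x = x \<or> x = - x)"
    using vector_choose_size[of 1] by auto
  show "symp (\<lambda>x y::real^3. norm x = 1 \<and> (y = x \<or> y = - x))"
    by (auto simp: symp_def)
  show "transp (\<lambda>x y::real^3. norm x = 1 \<and> (y = x \<or> y = - x))"
    by (auto simp: transp_def)
qed

definition sphere_preimage :: "elliptic_plane set \<Rightarrow> (real^3) set" where
  "sphere_preimage S = {x \<in> sphere 0 1. point_of x \<in> S}"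

text \<open>The quotient topology.\<close>

instantiation elliptic_plane :: topological_space
begin

definition open_elliptic_plane :: "elliptic_plane set \<Rightarrow> bool" where
  "open U \<longleftrightarrow> openin (top_of_set (sphere 0 1)) (sphere_preimage U)"

instance
proof
  have "sphere_preimage UNIV = sphere 0 1"
    by (auto simp: sphere_preimage_def)
  then show "open (UNIV :: elliptic_plane set)"
    by (simp add: open_elliptic_plane_def)
  show "open (S \<inter> T)" if "open S" "open T" for S T :: "elliptic_plane set"
  proof -
    have "sphere_preimage (S \<inter> T) = sphere_preimage S \<inter> sphere_preimage T"
      by (auto simp: sphere_preimage_def)
    then show ?thesis using that by (simp add: open_elliptic_plane_def openin_Int)
  qed
  show "open (\<Union>K)" if "\<forall>S\<in>K. open S" for K :: "elliptic_plane set set"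
  proof -
    have "sphere_preimage (\<Union>K) = \<Union>(sphere_preimage ` K)"
      by (auto simp: sphere_preimage_def)
    then show ?thesis using that by (auto simp: open_elliptic_plane_def intro!: openin_Union)
  qed
qed

end

definition is_line :: "elliptic_plane set \<Rightarrow> bool" where
  "is_line L \<longleftrightarrow> (\<exists>V. subspace V \<and> dim V = 2 \<and> L = point_of ` (V \<inter> sphere 0 1))"

definition full_dimensional :: "elliptic_plane set \<Rightarrow> bool" where
  "full_dimensional F \<longleftrightarrow> \<not> (\<exists>L. is_line L \<and> F \<subseteq> L)"

text \<open>
  Surface area on the unit sphere. In polar coordinates the volume element is
  \<open>r\<^sup>2 dr\<close> times the area element of the sphere, so the solid cone over \<open>A\<close> inside the
  unit ball has one third of the area of \<open>A\<close> as its volume.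
\<close>

definition sphere_area :: "(real^3) set \<Rightarrow> real" where
  "sphere_area A = 3 * measure lebesgue {r *\<^sub>R x | r x. 0 \<le> r \<and> r \<le> 1 \<and> x \<in> A}"

text \<open>Every point of the elliptic plane is covered by two points of the sphere.\<close>

definition elliptic_area :: "elliptic_plane set \<Rightarrow> real" where
  "elliptic_area S = sphere_area (sphere_preimage S) / 2"

lemma elliptic_area_UNIV: "elliptic_area UNIV = 2 * pi"
proof -
  have "{r *\<^sub>R x | r x. 0 \<le> r \<and> r \<le> 1 \<and> x \<in> sphere_preimage UNIV} = cball (0::real^3) 1"
  proof (intro set_eqI iffI)
    fix v :: "real^3" assume v: "v \<in> cball 0 1"
    obtain u :: "real^3" where u: "norm u = 1" using vector_choose_size[of 1] by auto
    define x where "x = (if v = 0 then u else v /\<^sub>R norm v)"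
    have "v = norm v *\<^sub>R x" "norm x = 1" using u by (auto simp: x_def)
    with v show "v \<in> {r *\<^sub>R x | r x. 0 \<le> r \<and> r \<le> 1 \<and> x \<in> sphere_preimage UNIV}"
      by (force simp: sphere_preimage_def)
  qed (auto simp: sphere_preimage_def)
  then show ?thesis
    by (simp add: elliptic_area_def sphere_area_def content_cball unit_ball_vol_3)
qed

lift_definition quad_form :: "real^3^3 \<Rightarrow> elliptic_plane \<Rightarrow> real" is
  "\<lambda>M x. x \<bullet> (M *v x)"
  by (auto simp: linear_neg[OF matrix_vector_mul_linear])

text \<open>
  The eigenvalues, with multiplicity, are the roots of the characteristic polynomial
  (\<open>mat t\<close> is \<open>t\<close> times the identity matrix). Invertibility and indefiniteness of \<open>M\<close>
  follow from their signs.
\<close>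

definition has_eigenvalues :: "real^3^3 \<Rightarrow> real \<Rightarrow> real \<Rightarrow> real \<Rightarrow> bool" where
  "has_eigenvalues M a b c \<longleftrightarrow> (\<forall>t. det (mat t - M) = (t - a) * (t - b) * (t - c))"

definition conic_matrix :: "real^3^3 \<Rightarrow> bool" where
  "conic_matrix M \<longleftrightarrow> transpose M = M \<and>
     (\<exists>\<nu>1 \<nu>2. \<nu>1 \<ge> \<nu>2 \<and> \<nu>2 > 0 \<and> has_eigenvalues M \<nu>1 \<nu>2 (-1))"

definition circle_matrix :: "real^3^3 \<Rightarrow> bool" where
  "circle_matrix M \<longleftrightarrow> transpose M = M \<and> (\<exists>\<nu>>0. has_eigenvalues M \<nu> \<nu> (-1))"

definition zero_set :: "real^3^3 \<Rightarrow> elliptic_plane set" where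
  "zero_set M = {p. quad_form M p = 0}"

definition is_conic :: "elliptic_plane set \<Rightarrow> bool" where
  "is_conic C \<longleftrightarrow> (\<exists>M. conic_matrix M \<and> C = zero_set M)"

definition is_circle :: "elliptic_plane set \<Rightarrow> bool" where
  "is_circle C \<longleftrightarrow> (\<exists>M. circle_matrix M \<and> C = zero_set M)"

text \<open>
  A conic, being a nondegenerate real curve, determines its normalized matrix, so the
  existential quantifiers over \<open>M\<close> below range over at most one matrix.
\<close>

definition conic_interior :: "elliptic_plane set \<Rightarrow> elliptic_plane set" where
  "conic_interior C = {p. \<exists>M. conic_matrix M \<and> C = zero_set M \<and> quad_form M p < 0}"

definition encloses :: "elliptic_plane set \<Rightarrow> elliptic_plane set \<Rightarrow> bool" where
  "encloses C F \<longleftrightarrow> (\<exists>M. conic_matrix M \<and> C = zero_set M \<and> (\<forall>p\<in>F. quad_form M p \<le> 0))"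

definition is_center :: "elliptic_plane \<Rightarrow> elliptic_plane set \<Rightarrow> bool" where
  "is_center p C \<longleftrightarrow> (\<exists>M x. conic_matrix M \<and> C = zero_set M \<and>
     norm x = 1 \<and> M *v x = - x \<and> p = point_of x)"

definition conic_area :: "elliptic_plane set \<Rightarrow> real" where
  "conic_area C = elliptic_area (conic_interior C)"

definition elliptic_bounded :: "elliptic_plane set \<Rightarrow> bool" where
  "elliptic_bounded F \<longleftrightarrow> (\<exists>C. is_circle C \<and> encloses C F)"

end

theory Submission imports Defs begin

text \<open>
  Choose orthonormal coordinates \<open>(y, z)\<close>, with \<open>y\<close> in the plane and \<open>z\<close> real, in which the
  given center is the \<open>z\<close>-axis. A conic with this center then has an equation
  \<open>q(y) = z\<^sup>2\<close> for a positive definite binary quadratic form \<open>q\<close>, the form is determined by the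
  conic, and the conic encloses \<open>F\<close> if and only if \<open>q(y) \<le> z\<^sup>2\<close> at all points of \<open>F\<close>
  (\<open>conic_matrix_determined\<close>, \<open>conic_central_matrix_iff\<close>, \<open>encloses_central\<close>). These
  inequalities are linear in the coefficients of \<open>q\<close>, so the admissible forms are a convex set.

  The idea is to see that the area is a strictly convex function of \<open>q\<close>. Area on the sphere
  is volume of cones, and the part of the unit ball outside the cone of the conic is
  \<open>z\<^sup>2 \<le> min (q(y)) (1 - |y|\<^sup>2)\<close>. Integrating over \<open>z\<close> first, its volume is twice
  the integral of the function \<open>sqrt (min (q(y)) (1 - |y|\<^sup>2))\<close> over the unit disc; this integral
  is called \<open>outer_volume\<close> here, and the area of the conic is \<open>2 \<pi> - 3 outer_volume\<close>
  (\<open>conic_area_central\<close>). The square root is concave and increasing, a minimum of a linear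
  function of \<open>q\<close> and a constant is concave in \<open>q\<close>, and near the origin the constant does not
  matter, so the outer volume is strictly concave in \<open>q\<close>
  (\<open>outer_volume_strictly_concave\<close>). Hence it has at most one maximum.

  For existence, relax positive definite to positive semidefinite. As \<open>F\<close> lies on no line, it
  has points with linearly independent \<open>y\<close>; the inequalities at these points bound the
  coefficients (\<open>coefficients_bounded\<close>), so the relaxed problem has a compact domain and a
  maximum. It remains to see that the maximum is not at a degenerate form
  (\<open>outer_volume_increases_from_degenerate\<close>). If \<open>q\<close> vanishes on a line and \<open>q'\<close> is an
  admissible definite form, then along the segment \<open>(1 - t) q + t q'\<close> the integrand grows
  initially at a rate of the order of \<open>1/s\<close> at distance \<open>s\<close> from that line. Because \<open>1/s\<close> is not
  integrable at \<open>0\<close>, this gain, of the order of \<open>t log(1/t)\<close>, beats the loss elsewhere,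
  which by concavity is of the order of \<open>t\<close> only.
\<close>

section \<open>Binary quadratic forms\<close>


text \<open>
  The triple \<open>(a, b, d)\<close> stands for the symmetric matrix with rows \<open>(a, b)\<close> and \<open>(b, d)\<close>.
  As a vector of \<open>\<real>\<^sup>3\<close> it makes the space of forms a Euclidean space, so that convexity and
  compactness of sets of forms have their usual meaning.
\<close>

definition binary_form :: "real \<times> real \<times> real \<Rightarrow> real \<times> real \<Rightarrow> real" where
  "binary_form A y = fst A * (fst y)\<^sup>2 + 2 * fst (snd A) * fst y * snd y + snd (snd A) * (snd y)\<^sup>2"

definition pos_semidef :: "real \<times> real \<times> real \<Rightarrow> bool" where
  "pos_semidef A \<longleftrightarrow> (\<forall>y. 0 \<le> binary_form A y)"

definition pos_def :: "real \<times> real \<times> real \<Rightarrow> bool" where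
  "pos_def A \<longleftrightarrow> (\<forall>y. y \<noteq> 0 \<longrightarrow> 0 < binary_form A y)"

lemma binary_form_linear: "binary_form (u *\<^sub>R A + v *\<^sub>R B) y = u * binary_form A y + v * binary_form B y"
  by (simp add: binary_form_def algebra_simps)

lemma binary_form_scaleR: "binary_form A (r *\<^sub>R y) = r\<^sup>2 * binary_form A y"
  by (simp add: binary_form_def algebra_simps power2_eq_square)

lemma binary_form_zero [simp]: "binary_form A 0 = 0" "binary_form 0 y = 0"
  by (simp_all add: binary_form_def)

lemma norm_pair_sq: "(norm y)\<^sup>2 = (fst y)\<^sup>2 + (snd y)\<^sup>2" for y :: "real \<times> real"
  by (cases y) (simp add: norm_Pair)

lemma pos_def_imp_pos_semidef: "pos_def A \<Longrightarrow> pos_semidef A"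
  unfolding pos_def_def pos_semidef_def by (metis less_eq_real_def binary_form_zero(1))

text \<open>
  Completing the square: \<open>a q(x, y) = (a x + b y)\<^sup>2 + (a d - b\<^sup>2) y\<^sup>2\<close>.
\<close>

lemma pos_def_iff: "pos_def (a, b, d) \<longleftrightarrow> 0 < a \<and> b\<^sup>2 < a * d"
proof
  assume A: "pos_def (a, b, d)"
  have a: "0 < a" using A[unfolded pos_def_def, rule_format, of "(1, 0)"] by (simp add: binary_form_def zero_prod_def)
  have "0 < binary_form (a, b, d) (- b, a)"
    using A[unfolded pos_def_def, rule_format, of "(- b, a)"] a by (simp add: zero_prod_def)
  also have "binary_form (a, b, d) (- b, a) = a * (a * d - b\<^sup>2)"
    by (simp add: binary_form_def power2_eq_square algebra_simps)
  finally show "0 < a \<and> b\<^sup>2 < a * d" using a by (simp add: zero_less_mult_iff)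
next
  assume A: "0 < a \<and> b\<^sup>2 < a * d"
  show "pos_def (a, b, d)" unfolding pos_def_def
  proof (intro allI impI)
    fix y :: "real \<times> real" assume "y \<noteq> 0"
    have *: "a * binary_form (a, b, d) y = (a * fst y + b * snd y)\<^sup>2 + (a * d - b\<^sup>2) * (snd y)\<^sup>2"
      by (simp add: binary_form_def power2_eq_square algebra_simps)
    have "0 < (a * fst y + b * snd y)\<^sup>2 + (a * d - b\<^sup>2) * (snd y)\<^sup>2"
    proof (cases "snd y = 0")
      case True
      then have "fst y \<noteq> 0" using \<open>y \<noteq> 0\<close> by (simp add: prod_eq_iff)
      then show ?thesis using True A by simp
    next
      case False
      then show ?thesis using A by (intro add_nonneg_pos) auto
    qed
    then show "0 < binary_form (a, b, d) y" using A * by (metis zero_less_mult_pos)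
  qed
qed

lemma pos_semidefD:
  assumes "pos_semidef (a, b, d)"
  shows "0 \<le> a" "0 \<le> d" "b\<^sup>2 \<le> a * d"
proof -
  have A: "0 \<le> binary_form (a, b, d) y" for y using assms unfolding pos_semidef_def by blast
  show a: "0 \<le> a" using A[of "(1, 0)"] by (simp add: binary_form_def)
  show "0 \<le> d" using A[of "(0, 1)"] by (simp add: binary_form_def)
  show "b\<^sup>2 \<le> a * d"
  proof (cases "a = 0")
    case True
    have "0 \<le> binary_form (a, b, d) (- (d + 1), 2 * b)" by (rule A)
    also have "\<dots> = - (4 * b\<^sup>2)" using True by (simp add: binary_form_def power2_eq_square algebra_simps)
    finally show ?thesis using True by simp
  next
    case False
    have "0 \<le> binary_form (a, b, d) (- b, a)" by (rule A)
    also have "\<dots> = a * (a * d - b\<^sup>2)" by (simp add: binary_form_def power2_eq_square algebra_simps)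
    finally show ?thesis using False a by (simp add: zero_le_mult_iff)
  qed
qed

lemma pos_semidef_combination:
  assumes "pos_semidef A" "pos_semidef B" "0 \<le> u" "0 \<le> v"
  shows "pos_semidef (u *\<^sub>R A + v *\<^sub>R B)"
  using assms by (simp add: pos_semidef_def binary_form_linear)

lemma binary_form_bound: "\<bar>binary_form (a, b, d) y\<bar> \<le> (\<bar>a\<bar> + 2 * \<bar>b\<bar> + \<bar>d\<bar>) * (norm y)\<^sup>2"
proof -
  have f: "\<bar>fst y\<bar> \<le> norm y" and s: "\<bar>snd y\<bar> \<le> norm y"
    by (metis norm_fst_le real_norm_def prod.collapse, metis norm_snd_le real_norm_def prod.collapse)
  have "\<bar>fst y\<bar> * \<bar>snd y\<bar> \<le> norm y * norm y" by (intro mult_mono f s) auto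
  then have p: "\<bar>fst y * snd y\<bar> \<le> (norm y)\<^sup>2" by (simp add: abs_mult power2_eq_square)
  have f2: "\<bar>(fst y)\<^sup>2\<bar> \<le> (norm y)\<^sup>2" and s2: "\<bar>(snd y)\<^sup>2\<bar> \<le> (norm y)\<^sup>2"
    by (simp_all add: norm_pair_sq)
  have "\<bar>binary_form (a, b, d) y\<bar> \<le> \<bar>a * (fst y)\<^sup>2\<bar> + \<bar>2 * b * (fst y * snd y)\<bar> + \<bar>d * (snd y)\<^sup>2\<bar>"
    by (simp add: binary_form_def mult.assoc)
  also have "\<dots> \<le> \<bar>a\<bar> * (norm y)\<^sup>2 + 2 * \<bar>b\<bar> * (norm y)\<^sup>2 + \<bar>d\<bar> * (norm y)\<^sup>2"
    using mult_left_mono[OF f2, of "\<bar>a\<bar>"] mult_left_mono[OF p, of "2 * \<bar>b\<bar>"]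
      mult_left_mono[OF s2, of "\<bar>d\<bar>"]
    by (simp add: abs_mult)
  finally show ?thesis by (simp add: algebra_simps)
qed

lemma continuous_on_binary_form_left: "continuous_on S (\<lambda>A. binary_form A y)"
  unfolding binary_form_def by (intro continuous_intros)

lemma continuous_on_binary_form_right: "continuous_on S (binary_form A)"
  unfolding binary_form_def by (intro continuous_intros)

text \<open>
  Compactness comes from here: two linearly independent vectors on which a semidefinite form is
  at most \<open>1\<close> control the whole form. The unit vectors are combinations of them, and on a
  combination \<open>u x + v y\<close> the parallelogram law bounds the form, since it is nonnegative at
  \<open>u x - v y\<close>.
\<close>

lemma coefficients_bounded:
  assumes A: "pos_semidef A" and det: "fst x * snd y - snd x * fst y \<noteq> 0"
    and le: "binary_form A x \<le> 1" "binary_form A y \<le> 1"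
  shows "norm A \<le> 4 * (((norm x)\<^sup>2 + (norm y)\<^sup>2) / (fst x * snd y - snd x * fst y)\<^sup>2)"
proof -
  obtain a b d where A_eq: "A = (a, b, d)" by (cases A) auto
  define \<delta> where "\<delta> = fst x * snd y - snd x * fst y"
  define N where "N = ((norm x)\<^sup>2 + (norm y)\<^sup>2) / \<delta>\<^sup>2"
  have q: "0 \<le> binary_form A z" for z using A unfolding pos_semidef_def by blast
  have par: "binary_form A (u *\<^sub>R x + v *\<^sub>R y) \<le> 2 * u\<^sup>2 + 2 * v\<^sup>2" for u v
  proof -
    have "binary_form A (u *\<^sub>R x + v *\<^sub>R y) + binary_form A (u *\<^sub>R x + (- v) *\<^sub>R y) = 2 * u\<^sup>2 * binary_form A x + 2 * v\<^sup>2 * binary_form A y"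
      by (simp add: binary_form_def power2_eq_square algebra_simps)
    also have "\<dots> \<le> 2 * u\<^sup>2 * 1 + 2 * v\<^sup>2 * 1" using le by (intro add_mono mult_left_mono) auto
    finally show ?thesis using q[of "u *\<^sub>R x + (- v) *\<^sub>R y"] by simp
  qed
  have \<delta>: "\<delta> \<noteq> 0" using det by (simp add: \<delta>_def)
  have one: "snd y / \<delta> * fst x - snd x / \<delta> * fst y = 1"
  proof -
    have "snd y / \<delta> * fst x - snd x / \<delta> * fst y = (fst x * snd y - snd x * fst y) / \<delta>"
      by (simp add: diff_divide_distrib mult.commute)
    also have "\<dots> = \<delta> / \<delta>" by (simp only: \<delta>_def)
    finally have "snd y / \<delta> * fst x - snd x / \<delta> * fst y = \<delta> / \<delta>" .
    then show ?thesis using \<delta> by simp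
  qed
  then have e1: "(1, 0) = (snd y / \<delta>) *\<^sub>R x + (- snd x / \<delta>) *\<^sub>R y"
    by (simp add: prod_eq_iff)
  have "binary_form A (1, 0) \<le> 2 * (snd y / \<delta>)\<^sup>2 + 2 * (- snd x / \<delta>)\<^sup>2"
    unfolding e1 by (rule par)
  moreover have e2: "(0, 1) = (- fst y / \<delta>) *\<^sub>R x + (fst x / \<delta>) *\<^sub>R y"
    using one by (simp add: prod_eq_iff mult.commute)
  have "binary_form A (0, 1) \<le> 2 * (- fst y / \<delta>)\<^sup>2 + 2 * (fst x / \<delta>)\<^sup>2"
    unfolding e2 by (rule par)
  ultimately have ad: "a + d \<le> 2 * N"
    by (simp add: A_eq binary_form_def N_def norm_pair_sq power_divide add_divide_distrib)
  have b: "\<bar>b\<bar> \<le> (a + d) / 2"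
    using q[of "(1, 1)"] q[of "(1, -1)"] by (simp add: A_eq binary_form_def)
  have "norm A \<le> norm a + norm (b, d)" unfolding A_eq by (rule norm_Pair_le)
  also have "\<dots> \<le> \<bar>a\<bar> + (\<bar>b\<bar> + \<bar>d\<bar>)" using norm_Pair_le[of b d] by simp
  also have "\<dots> \<le> 2 * (a + d)" using b pos_semidefD(1,2)[OF A[unfolded A_eq]] by simp
  also have "\<dots> \<le> 4 * N" using ad by simp
  finally show ?thesis by (simp add: N_def \<delta>_def)
qed

section \<open>The volume outside a central cone\<close>

text \<open>
  Half the length of the vertical segment over \<open>y\<close> that lies in the unit ball and outside the
  cone \<open>q(y) < z\<^sup>2\<close>. The outer maximum makes it \<open>0\<close> where \<open>y\<close> is outside the unit disc.
\<close>

definition outer_height :: "real \<times> real \<times> real \<Rightarrow> real \<times> real \<Rightarrow> real" where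
  "outer_height A y = sqrt (max 0 (min (binary_form A y) (1 - (norm y)\<^sup>2)))"

definition outer_volume :: "real \<times> real \<times> real \<Rightarrow> real" where
  "outer_volume A = (\<integral>y. outer_height A y \<partial>lborel)"

lemma continuous_on_outer_height: "continuous_on S (outer_height A)"
  unfolding outer_height_def by (intro continuous_intros continuous_on_binary_form_right)

lemma outer_height_measurable [measurable]: "outer_height A \<in> borel_measurable borel"
  by (intro borel_measurable_continuous_onI continuous_on_outer_height)

lemma outer_height_nonneg: "0 \<le> outer_height A y"
  by (simp add: outer_height_def)

lemma outer_height_le_indicator: "outer_height A y \<le> indicator (cball 0 1) y"
proof (cases "norm y \<le> 1")
  case True
  then show ?thesis by (simp add: outer_height_def min.coboundedI2)
next
  case False
  then have "1 < (norm y)\<^sup>2" by (simp add: one_less_power)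
  then show ?thesis using False by (simp add: outer_height_def min.coboundedI2)
qed

lemma integrable_unit_disc: "integrable lborel (indicator (cball 0 1) :: real \<times> real \<Rightarrow> real)"
  by (intro integrable_real_indicator) (use emeasure_lborel_cball_finite[of 0 1] in auto)

lemma integrable_outer_height: "integrable lborel (outer_height A)"
  by (rule Bochner_Integration.integrable_bound[OF integrable_unit_disc])
     (auto simp: outer_height_nonneg outer_height_le_indicator intro!: AE_I2)

lemma outer_volume_nonneg: "0 \<le> outer_volume A"
  unfolding outer_volume_def by (simp add: outer_height_nonneg)

text \<open>
  All the functions \<open>outer_height A\<close> are dominated by the indicator of the unit disc.
\<close>

lemma continuous_on_outer_volume: "continuous_on S outer_volume"
proof (subst continuous_on_sequentially, intro allI ballI impI)
  fix X :: "nat \<Rightarrow> real \<times> real \<times> real" and A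
  assume "A \<in> S" and X: "(\<forall>n. X n \<in> S) \<and> X \<longlonglongrightarrow> A"
  have "(\<lambda>n. \<integral>y. outer_height (X n) y \<partial>lborel) \<longlonglongrightarrow> (\<integral>y. outer_height A y \<partial>lborel)"
  proof (rule integral_dominated_convergence[OF _ _ integrable_unit_disc])
    show "AE y in lborel. (\<lambda>n. outer_height (X n) y) \<longlonglongrightarrow> outer_height A y"
    proof (rule AE_I2)
      fix y :: "real \<times> real"
      have "(\<lambda>n. binary_form (X n) y) \<longlonglongrightarrow> binary_form A y"
        using X continuous_on_tendsto_compose[OF continuous_on_binary_form_left[of UNIV y], of X A] by simp
      then show "(\<lambda>n. outer_height (X n) y) \<longlonglongrightarrow> outer_height A y"
        unfolding outer_height_def by (intro tendsto_intros)
    qed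
  qed (auto simp: outer_height_nonneg outer_height_le_indicator intro!: AE_I2)
  then show "(outer_volume \<circ> X) \<longlonglongrightarrow> outer_volume A"
    by (simp add: outer_volume_def o_def)
qed

lemma sqrt_concave:
  assumes "0 \<le> p" "0 \<le> q" "0 \<le> u" "0 \<le> v" "u + v = 1"
  shows "u * sqrt p + v * sqrt q \<le> sqrt (u * p + v * q)"
proof (rule real_le_rsqrt)
  have v: "v = 1 - u" using assms by simp
  have "u * p + v * q - (u * sqrt p + v * sqrt q)\<^sup>2 = u * v * (sqrt p - sqrt q)\<^sup>2 "
  proof -
    have "p = sqrt p * sqrt p" "q = sqrt q * sqrt q" using assms by simp_all
    then obtain x z where "p = x * x" "q = z * z" "sqrt p = x" "sqrt q = z" by metis
    then show ?thesis unfolding v by (simp add: algebra_simps power2_eq_square)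
  qed
  moreover have "0 \<le> u * v * (sqrt p - sqrt q)\<^sup>2" using assms by simp
  ultimately show "(u * sqrt p + v * sqrt q)\<^sup>2 \<le> u * p + v * q" by linarith
qed

lemma sqrt_strictly_concave:
  assumes "0 \<le> p" "0 \<le> q" "p \<noteq> q"
  shows "(1/2) * sqrt p + (1/2) * sqrt q < sqrt ((1/2) * p + (1/2) * q)"
proof (rule real_less_rsqrt)
  have "(1/2) * p + (1/2) * q - ((1/2) * sqrt p + (1/2) * sqrt q)\<^sup>2 = 1/4 * (sqrt p - sqrt q)\<^sup>2"
  proof -
    have "p = sqrt p * sqrt p" "q = sqrt q * sqrt q" using assms by simp_all
    then obtain x z where "p = x * x" "q = z * z" "sqrt p = x" "sqrt q = z" by metis
    then show ?thesis by (simp add: algebra_simps power2_eq_square)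
  qed
  moreover have "0 < 1/4 * (sqrt p - sqrt q)\<^sup>2" using assms by simp
  ultimately show "((1/2) * sqrt p + (1/2) * sqrt q)\<^sup>2 < (1/2) * p + (1/2) * q" by linarith
qed

text \<open>
  At a fixed \<open>y\<close> the height is a concave increasing function of the minimum of a constant and
  a linear function of the form. Semidefiniteness keeps the argument of the root nonnegative;
  the square root of the positive part is not concave across \<open>0\<close>.
\<close>

lemma outer_height_concave:
  assumes "pos_semidef A" "pos_semidef B" "0 \<le> u" "0 \<le> v" "u + v = 1"
  shows "u * outer_height A y + v * outer_height B y \<le> outer_height (u *\<^sub>R A + v *\<^sub>R B) y"
proof (cases "norm y \<le> 1")
  case True
  define h where "h = 1 - (norm y)\<^sup>2"
  have h: "0 \<le> h" using True by (simp add: h_def power_le_one)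
  have q: "0 \<le> binary_form A y" "0 \<le> binary_form B y" using assms unfolding pos_semidef_def by blast+
  have "u * outer_height A y + v * outer_height B y = u * sqrt (min (binary_form A y) h) + v * sqrt (min (binary_form B y) h)"
    using h q by (simp add: outer_height_def h_def[symmetric] max_def)
  also have "\<dots> \<le> sqrt (u * min (binary_form A y) h + v * min (binary_form B y) h)"
    using h q assms by (intro sqrt_concave) auto
  also have "\<dots> \<le> sqrt (max 0 (min (u * binary_form A y + v * binary_form B y) h))"
  proof (rule real_sqrt_le_mono)
    have "u * min (binary_form A y) h + v * min (binary_form B y) h \<le> u * h + v * h"
      using assms by (intro add_mono mult_left_mono) auto
    also have "\<dots> = h" using assms by (metis distrib_right mult_1)
    finally have "u * min (binary_form A y) h + v * min (binary_form B y) h \<le> h" .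
    moreover have "u * min (binary_form A y) h + v * min (binary_form B y) h \<le> u * binary_form A y + v * binary_form B y"
      using assms by (intro add_mono mult_left_mono) auto
    ultimately show "u * min (binary_form A y) h + v * min (binary_form B y) h
        \<le> max 0 (min (u * binary_form A y + v * binary_form B y) h)" by simp
  qed
  finally show ?thesis by (simp add: outer_height_def binary_form_linear h_def)
next
  case False
  then have "outer_height A y = 0" "outer_height B y = 0"
    using outer_height_le_indicator[of A y] outer_height_nonneg[of A y]
      outer_height_le_indicator[of B y] outer_height_nonneg[of B y] by auto
  then show ?thesis by (simp add: outer_height_nonneg)
qed

text \<open>
  Near the origin the bound \<open>1 - |y|\<^sup>2\<close> is inactive, and only the form matters.
\<close>

lemma outer_height_near_zero:
  obtains r where "0 < r" "\<And>y. norm y \<le> r \<Longrightarrow> outer_height A y = sqrt (max 0 (binary_form A y))"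
    "\<And>y. norm y \<le> r \<Longrightarrow> binary_form A y \<le> 1/2"
proof -
  obtain a b d where A: "A = (a, b, d)" by (cases A) auto
  define K where "K = 1 + \<bar>a\<bar> + 2 * \<bar>b\<bar> + \<bar>d\<bar>"
  have K: "1 \<le> K" by (simp add: K_def)
  define r where "r = 1 / (2 * K)"
  have r: "0 < r" using K by (simp add: r_def)
  have Kr: "K * r\<^sup>2 \<le> 1/2"
  proof -
    have "K * r\<^sup>2 = (1/2) * (1 / (2 * K))" using K by (simp add: r_def power2_eq_square field_simps)
    also have "\<dots> \<le> (1/2) * 1" using K by (intro mult_left_mono) auto
    finally show ?thesis by simp
  qed
  have *: "binary_form A y \<le> 1/2 \<and> (norm y)\<^sup>2 \<le> 1/2" if "norm y \<le> r" for y
  proof -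
    have n: "(norm y)\<^sup>2 \<le> r\<^sup>2" using that by (intro power_mono) auto
    have "binary_form A y \<le> (\<bar>a\<bar> + 2 * \<bar>b\<bar> + \<bar>d\<bar>) * (norm y)\<^sup>2" using binary_form_bound[of a b d y] A by simp
    also have "\<dots> \<le> K * r\<^sup>2" using n by (intro mult_mono) (auto simp: K_def)
    finally have "binary_form A y \<le> 1/2" using Kr by simp
    moreover have "(norm y)\<^sup>2 \<le> 1/2" using n Kr K mult_right_mono[of 1 K "r\<^sup>2"] by simp
    ultimately show ?thesis by simp
  qed
  show ?thesis
  proof (rule that[OF r])
    fix y :: "real \<times> real" assume "norm y \<le> r"
    from *[OF this] show "binary_form A y \<le> 1/2" "outer_height A y = sqrt (max 0 (binary_form A y))"
      by (auto simp: outer_height_def)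
  qed
qed

lemma integral_pos_of_continuous:
  fixes f :: "'a::euclidean_space \<Rightarrow> real"
  assumes "continuous_on UNIV f" "integrable lborel f" "\<And>x. 0 \<le> f x" "0 < f x0"
  shows "0 < (\<integral>x. f x \<partial>lborel)"
proof -
  have ne: "(\<integral>x. f x \<partial>lborel) \<noteq> 0"
  proof
    assume "(\<integral>x. f x \<partial>lborel) = 0"
    then have "AE x in lborel. f x = 0"
      using integral_nonneg_eq_0_iff_AE[OF assms(2)] assms(3) by simp
    then have ae: "AE x in lebesgue. f x = 0" by (rule AE_completion)
    have "open {x. 0 < f x}"
      using assms(1) by (intro open_Collect_less) auto
    then have "\<not> negligible {x. 0 < f x}"
      using assms(4) by (intro open_not_negligible) auto
    moreover have "negligible {x. 0 < f x}"
      unfolding negligible_iff_null_sets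
    proof (subst AE_iff_null_sets)
      show "{x. 0 < f x} \<in> sets lebesgue" using \<open>open {x. 0 < f x}\<close> by simp
      show "AE x in lebesgue. x \<notin> {x. 0 < f x}" using ae by (rule eventually_mono) simp
    qed
    ultimately show False by simp
  qed
  moreover have "0 \<le> (\<integral>x. f x \<partial>lborel)" using assms(3) by simp
  ultimately show ?thesis by simp
qed

lemma binary_form_eqI:
  assumes "\<And>y. binary_form A y = binary_form B y" shows "A = B"
  using assms[of "(1, 0)"] assms[of "(0, 1)"] assms[of "(1, 1)"]
  by (cases A; cases B) (auto simp: binary_form_def)

text \<open>
  Two different forms differ at some \<open>y\<close>, hence by homogeneity at arbitrarily small multiples of
  \<open>y\<close>. There both heights are square roots of different numbers, so the concavity inequality of
  the heights is strict at one point and, by continuity, on a set of positive measure.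
\<close>

lemma outer_volume_strictly_concave:
  assumes "pos_semidef A" "pos_semidef B" "A \<noteq> B"
  shows "(outer_volume A + outer_volume B) / 2 < outer_volume ((1/2) *\<^sub>R A + (1/2) *\<^sub>R B)"
proof -
  let ?C = "(1/2) *\<^sub>R A + (1/2) *\<^sub>R B"
  define g where "g y = outer_height ?C y - ((1/2) * outer_height A y + (1/2) * outer_height B y)" for y
  have g_int: "integrable lborel g" unfolding g_def
    by (intro Bochner_Integration.integrable_diff Bochner_Integration.integrable_add
        integrable_mult_right integrable_outer_height)
  obtain y where y: "binary_form A y \<noteq> binary_form B y" using assms(3) binary_form_eqI by blast
  then have "y \<noteq> 0" by auto
  obtain r where r: "0 < r" "\<And>y. norm y \<le> r \<Longrightarrow> outer_height A y = sqrt (max 0 (binary_form A y))"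
    by (rule outer_height_near_zero[of A]) blast
  obtain r' where r': "0 < r'" "\<And>y. norm y \<le> r' \<Longrightarrow> outer_height B y = sqrt (max 0 (binary_form B y))"
    by (rule outer_height_near_zero[of B]) blast
  obtain r'' where r'': "0 < r''" "\<And>y. norm y \<le> r'' \<Longrightarrow> outer_height ?C y = sqrt (max 0 (binary_form ?C y))"
    by (rule outer_height_near_zero[of ?C]) blast
  define s where "s = Min {r, r', r''} / norm y"
  have s: "0 < s" using r r' r'' \<open>y \<noteq> 0\<close> by (simp add: s_def)
  define x where "x = s *\<^sub>R y"
  have nx: "norm x = Min {r, r', r''}" using s \<open>y \<noteq> 0\<close> r r' r'' by (simp add: x_def s_def)
  have ne: "binary_form A x \<noteq> binary_form B x" using y s by (simp add: x_def binary_form_scaleR)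
  have q: "0 \<le> binary_form A x" "0 \<le> binary_form B x" using assms unfolding pos_semidef_def by blast+
  have "outer_height A x = sqrt (binary_form A x)" "outer_height B x = sqrt (binary_form B x)"
      "outer_height ?C x = sqrt ((1/2) * binary_form A x + (1/2) * binary_form B x)"
    using r(2)[of x] r'(2)[of x] r''(2)[of x] nx q by (simp_all add: binary_form_linear)
  then have pos: "0 < g x" using sqrt_strictly_concave[OF q ne] by (simp add: g_def)
  have "0 < (\<integral>y. g y \<partial>lborel)"
  proof (rule integral_pos_of_continuous[OF _ g_int _ pos])
    show "continuous_on UNIV g" unfolding g_def
      by (intro continuous_intros continuous_on_outer_height)
    show "0 \<le> g y" for y
      using outer_height_concave[OF assms(1,2), of "1/2" "1/2" y] by (simp add: g_def)
  qed
  also have "(\<integral>y. g y \<partial>lborel) = outer_volume ?C - ((1/2) * outer_volume A + (1/2) * outer_volume B)"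
    unfolding g_def outer_volume_def using integrable_outer_height by simp
  finally show ?thesis by simp
qed

section \<open>Degenerate forms are not maximal\<close>

lemma outer_volume_pos:
  assumes "pos_def A"
  shows "0 < outer_volume A"
proof -
  have "(outer_volume A + outer_volume 0) / 2 < outer_volume ((1/2) *\<^sub>R A + (1/2) *\<^sub>R 0)"
  proof (rule outer_volume_strictly_concave)
    show "A \<noteq> 0" using assms[unfolded pos_def_def, rule_format, of "(1, 0)"] by (auto simp: zero_prod_def binary_form_def)
  qed (auto simp: pos_semidef_def pos_def_imp_pos_semidef[OF assms, unfolded pos_semidef_def])
  also have "\<dots> \<le> outer_volume A" unfolding outer_volume_def
  proof (rule integral_mono[OF integrable_outer_height integrable_outer_height])
    fix y
    have "0 \<le> binary_form A y" using pos_def_imp_pos_semidef[OF assms] unfolding pos_semidef_def by blast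
    then show "outer_height ((1/2) *\<^sub>R A + (1/2) *\<^sub>R 0) y \<le> outer_height A y"
      unfolding outer_height_def binary_form_linear binary_form_zero by (intro real_sqrt_le_mono) auto
  qed
  finally show ?thesis using outer_volume_nonneg[of 0] by simp
qed

lemma outer_volume_swap: "outer_volume (d, b, a) = outer_volume (a, b, d)"
proof -
  have "outer_volume (a, b, d) = (\<integral>y. outer_height (a, b, d) y \<partial>(lborel \<Otimes>\<^sub>M lborel))"
    by (simp add: outer_volume_def lborel_prod)
  also have "\<dots> = (\<integral>(x, y). outer_height (a, b, d) (y, x) \<partial>(lborel \<Otimes>\<^sub>M lborel))"
    by (rule lborel_pair.integral_product_swap[symmetric]) (simp add: lborel_prod)
  also have "\<dots> = (\<integral>y. outer_height (d, b, a) y \<partial>(lborel \<Otimes>\<^sub>M lborel))"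
    by (rule Bochner_Integration.integral_cong)
       (auto simp: outer_height_def binary_form_def norm_Pair algebra_simps)
  also have "\<dots> = outer_volume (d, b, a)" by (simp add: outer_volume_def lborel_prod)
  finally show ?thesis by simp
qed

lemma integral_reciprocal:
  fixes k \<tau> \<sigma> c :: real
  assumes "0 < k" "0 < \<tau>" "0 \<le> \<sigma>" "0 \<le> c"
  shows "(\<integral>s. c / (k * s + \<tau>) * indicator {0..\<sigma>} s \<partial>lborel) = c / k * ln ((k * \<sigma> + \<tau>) / \<tau>)"
proof -
  have "(\<integral>s. c / (k * s + \<tau>) * indicator {0..\<sigma>} s \<partial>lborel)
      = c / k * ln (k * \<sigma> + \<tau>) - c / k * ln (k * 0 + \<tau>)"
  proof (rule integral_FTC_Icc_nonneg)
    fix s :: real assume "s \<in> {0..\<sigma>}"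
    then have pos: "0 < k * s + \<tau>" using assms by (simp add: add_nonneg_pos)
    then show "((\<lambda>s. c / k * ln (k * s + \<tau>)) has_real_derivative c / (k * s + \<tau>)) (at s)"
      using assms(1) by (auto intro!: derivative_eq_intros)
    show "0 \<le> c / (k * s + \<tau>)" using pos assms by simp
  qed (use assms in auto)
  also have "\<dots> = c / k * (ln (k * \<sigma> + \<tau>) - ln \<tau>)" by (simp add: algebra_simps)
  also have "ln (k * \<sigma> + \<tau>) - ln \<tau> = ln ((k * \<sigma> + \<tau>) / \<tau>)"
    using assms by (subst ln_divide_pos) (auto intro: add_nonneg_pos)
  finally show ?thesis .
qed

text \<open>
  Fubini and translation invariance in the first coordinate: shearing does not change the
  integral. This lets the null line of a rank one form be straightened to a coordinate axis.
\<close>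

lemma integral_sheared_strip:
  fixes \<phi> :: "real \<Rightarrow> real"
  assumes int: "integrable lborel (\<lambda>y::real \<times> real. indicator {\<eta>..\<theta>} (snd y) * \<phi> (fst y + \<beta> * snd y))"
    and "\<eta> \<le> \<theta>"
  shows "(\<integral>y. indicator {\<eta>..\<theta>} (snd y) * \<phi> (fst y + \<beta> * snd y) \<partial>lborel)
    = (\<theta> - \<eta>) * (\<integral>s. \<phi> s \<partial>lborel)"
proof -
  have int': "integrable (lborel \<Otimes>\<^sub>M lborel)
      (\<lambda>(x, y). indicator {\<eta>..\<theta>} y * \<phi> (x + \<beta> * y))"
    using int by (simp add: lborel_prod case_prod_beta')
  have "(\<integral>y. indicator {\<eta>..\<theta>} (snd y) * \<phi> (fst y + \<beta> * snd y) \<partial>lborel)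
      = (\<integral>(x, y). indicator {\<eta>..\<theta>} y * \<phi> (x + \<beta> * y) \<partial>(lborel \<Otimes>\<^sub>M lborel))"
    by (simp add: lborel_prod case_prod_beta')
  also have "\<dots> = (\<integral>y. (\<integral>x. indicator {\<eta>..\<theta>} y * \<phi> (x + \<beta> * y) \<partial>lborel) \<partial>lborel)"
    by (rule lborel_pair.integral_snd[OF int', symmetric])
  also have "\<dots> = (\<integral>y. indicator {\<eta>..\<theta>} y * (\<integral>s. \<phi> s \<partial>lborel) \<partial>lborel)"
  proof (rule Bochner_Integration.integral_cong[OF refl])
    fix y :: real
    show "(\<integral>x. indicator {\<eta>..\<theta>} y * \<phi> (x + \<beta> * y) \<partial>lborel)
        = indicator {\<eta>..\<theta>} y * (\<integral>s. \<phi> s \<partial>lborel)"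
      using lborel_integral_real_affine[of 1 \<phi> "\<beta> * y"] by (simp add: add.commute)
  qed
  also have "\<dots> = (\<theta> - \<eta>) * (\<integral>s. \<phi> s \<partial>lborel)"
    using assms(2) by simp
  finally show ?thesis .
qed

text \<open>
  The increment of the root is the increment of the argument divided by the sum of the roots. As
  \<open>p\<close> tends to \<open>0\<close>, the bound per unit of \<open>t\<close> tends to a multiple of \<open>1 / sqrt t\<close>; this is
  what makes the gain near the null line of a degenerate form large.
\<close>

lemma sqrt_increment:
  fixes p q t \<mu> :: real
  assumes "0 \<le> p" "p \<le> \<mu> / 2" "\<mu> \<le> q" "q \<le> 1" "0 < t" "t \<le> 1"
  shows "t * ((\<mu> / 2) / (2 * sqrt p + sqrt t)) \<le> sqrt ((1 - t) * p + t * q) - sqrt p"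
proof -
  define r where "r = (1 - t) * p + t * q"
  have mu: "0 \<le> \<mu>" using assms by simp
  have r: "p \<le> r"
  proof -
    have "t * p \<le> t * q" using assms by (intro mult_left_mono) auto
    then show ?thesis by (simp add: r_def algebra_simps)
  qed
  have "sqrt r \<le> sqrt (p + t)"
  proof (rule real_sqrt_le_mono)
    have "(1 - t) * p \<le> 1 * p" using assms by (intro mult_right_mono) auto
    moreover have "t * q \<le> t * 1" using assms by (intro mult_left_mono) auto
    ultimately show "r \<le> p + t" by (simp add: r_def)
  qed
  also have "\<dots> \<le> sqrt p + sqrt t" using assms by (intro sqrt_add_le_add_sqrt) auto
  finally have den: "sqrt r + sqrt p \<le> 2 * sqrt p + sqrt t" by simp
  have pos: "0 < 2 * sqrt p + sqrt t" using assms by (simp add: add_nonneg_pos)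
  have "t * (\<mu> / 2) \<le> t * (q - p)" using assms by (intro mult_left_mono) auto
  also have "\<dots> = r - p" by (simp add: r_def algebra_simps)
  also have "\<dots> = (sqrt r - sqrt p) * (sqrt r + sqrt p)"
    using assms r by (simp add: algebra_simps)
  also have "\<dots> \<le> (sqrt r - sqrt p) * (2 * sqrt p + sqrt t)"
    using r den by (intro mult_left_mono) auto
  finally have "t * (\<mu> / 2) / (2 * sqrt p + sqrt t) \<le> sqrt r - sqrt p"
    by (subst pos_divide_le_eq[OF pos])
  then show ?thesis by (simp add: r_def)
qed

text \<open>
  Let \<open>s\<close> be the linear function with \<open>q = a s\<^sup>2\<close>. On a parallelogram \<open>0 \<le> s \<le> \<sigma>\<close> next to
  the null line the height grows by at least \<open>t c / (k s + sqrt t)\<close>, and elsewhere concavity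
  limits its loss to \<open>t\<close> times the old height. Integrated and divided by \<open>t\<close>, the gain is at
  least a constant times \<open>ln (k \<sigma> / sqrt t)\<close>, which is unbounded as \<open>t\<close> tends to \<open>0\<close>,
  while the loss is at most the old volume.
\<close>

lemma outer_volume_increases_from_rank_one:
  assumes a: "0 < a" and deg: "a * d = b\<^sup>2" and B: "pos_def B"
  obtains t where "0 < t" "t \<le> 1" "outer_volume (a, b, d) < outer_volume ((1 - t) *\<^sub>R (a, b, d) + t *\<^sub>R B)"
proof -
  let ?A = "(a, b, d)"
  obtain a0 b0 d0 where B_eq: "B = (a0, b0, d0)" by (cases B) auto
  have B0: "0 < a0" "b0\<^sup>2 < a0 * d0" using B by (simp_all add: B_eq pos_def_iff)
  define \<beta> where "\<beta> = b / a"
  have qA: "binary_form ?A y = a * (fst y + \<beta> * snd y)\<^sup>2" for y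
  proof -
    have "d = b\<^sup>2 / a" using deg a by (simp add: field_simps)
    then show ?thesis using a by (simp add: binary_form_def \<beta>_def power2_eq_square field_simps)
  qed
  have psdA: "pos_semidef ?A" unfolding pos_semidef_def using qA a by simp
  have psdB: "pos_semidef B" by (rule pos_def_imp_pos_semidef[OF B])
  obtain r1 where r1: "0 < r1" "\<And>y. norm y \<le> r1 \<Longrightarrow> outer_height ?A y = sqrt (max 0 (binary_form ?A y))"
      "\<And>y. norm y \<le> r1 \<Longrightarrow> binary_form ?A y \<le> 1/2"
    by (rule outer_height_near_zero[of ?A]) blast
  obtain r2 where r2: "0 < r2" "\<And>y. norm y \<le> r2 \<Longrightarrow> outer_height B y = sqrt (max 0 (binary_form B y))"
      "\<And>y. norm y \<le> r2 \<Longrightarrow> binary_form B y \<le> 1/2"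
    by (rule outer_height_near_zero[of B]) blast
  define r where "r = min (1/2) (min r1 r2)"
  have r: "0 < r" "r \<le> r1" "r \<le> r2" "r \<le> 1/2" using r1 r2 by (auto simp: r_def)
  \<comment> \<open>The parallelogram \<open>\<eta> \<le> snd y \<le> 2 * \<eta>\<close>, \<open>0 \<le> s \<le> \<sigma>\<close> has to lie in the disc of radius \<open>r\<close>:
    there \<open>\<bar>fst y\<bar> + \<bar>snd y\<bar> \<le> \<sigma> + 2 * (1 + \<bar>\<beta>\<bar>) * \<eta>\<close>, and each of the two summands gets \<open>r / 2\<close>.\<close>
  define \<eta> where "\<eta> = r / (4 * (1 + \<bar>\<beta>\<bar>))"
  have \<eta>: "0 < \<eta>" using r by (simp add: \<eta>_def add_pos_nonneg)
  \<comment> \<open>\<open>\<mu>\<close> is a lower bound of \<open>B\<close> where \<open>\<eta> \<le> snd y\<close>, and \<open>\<sigma>\<close> keeps the rank one form below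
    \<open>\<mu> / 2\<close>.\<close>
  define \<mu> where "\<mu> = (a0 * d0 - b0\<^sup>2) / a0 * \<eta>\<^sup>2"
  have \<mu>: "0 < \<mu>" using B0 \<eta> by (simp add: \<mu>_def)
  define \<sigma> where "\<sigma> = min (r/2) (sqrt (\<mu> / (2 * a)))"
  have \<sigma>: "0 < \<sigma>" "\<sigma> \<le> r/2" "\<sigma> \<le> sqrt (\<mu> / (2 * a))" using r \<mu> a by (simp_all add: \<sigma>_def)
  define k where "k = 2 * sqrt a"
  define c where "c = \<mu> / 2"
  have k: "0 < k" and c: "0 < c" using a \<mu> by (simp_all add: k_def c_def)
  \<comment> \<open>Chosen so that \<open>\<eta> * c / k * ln (k * \<sigma> / \<tau>)\<close> is at least the volume of the rank one form.\<close>
  define \<tau> where "\<tau> = min 1 (k * \<sigma> * exp (- (outer_volume ?A * k / (\<eta> * c))))"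
  have \<tau>: "0 < \<tau>" "\<tau> \<le> 1" "\<tau> \<le> k * \<sigma> * exp (- (outer_volume ?A * k / (\<eta> * c)))"
    using k \<sigma> by (simp_all add: \<tau>_def)
  define t where "t = \<tau>\<^sup>2"
  have t: "0 < t" "t \<le> 1" "sqrt t = \<tau>" using \<tau> by (simp_all add: t_def power_le_one)
  let ?C = "(1 - t) *\<^sub>R ?A + t *\<^sub>R B"
  define \<phi> where "\<phi> s = c / (k * s + \<tau>) * indicator {0..\<sigma>} s" for s
  define D where "D y = indicator {\<eta>..2 * \<eta>} (snd y) * \<phi> (fst y + \<beta> * snd y)" for y :: "real \<times> real"
  have \<phi>_nonneg: "0 \<le> \<phi> s" for s
    using k c \<tau> by (auto simp: \<phi>_def indicator_def)
  then have D_nonneg: "0 \<le> D y" for y by (simp add: D_def)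

  \<comment> \<open>Outside the parallelogram \<open>D\<close> vanishes, and the inequality is concavity; inside it is
    \<open>sqrt_increment\<close>.\<close>
  have key: "t * D y \<le> outer_height ?C y - outer_height ?A y + t * outer_height ?A y" for y
  proof (cases "snd y \<in> {\<eta>..2 * \<eta>} \<and> fst y + \<beta> * snd y \<in> {0..\<sigma>}")
    case False
    then have "D y = 0" by (auto simp: D_def \<phi>_def indicator_def)
    moreover have "(1 - t) * outer_height ?A y + t * outer_height B y \<le> outer_height ?C y"
      by (rule outer_height_concave[OF psdA psdB]) (use t in auto)
    moreover have "0 \<le> t * outer_height B y" using t outer_height_nonneg by simp
    ultimately show ?thesis by (simp add: algebra_simps)
  next
    case True
    define s where "s = fst y + \<beta> * snd y"
    have s: "0 \<le> s" "s \<le> \<sigma>" and y2: "\<eta> \<le> snd y" "snd y \<le> 2 * \<eta>" using True by (auto simp: s_def)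
    have ny: "norm y \<le> r"
    proof -
      have "norm y \<le> \<bar>fst y\<bar> + \<bar>snd y\<bar>" using norm_Pair_le[of "fst y" "snd y"] by simp
      also have "\<bar>fst y\<bar> \<le> \<bar>s\<bar> + \<bar>\<beta> * snd y\<bar>" by (simp add: s_def)
      also have "\<bar>\<beta> * snd y\<bar> = \<bar>\<beta>\<bar> * snd y" using y2 \<eta> by (simp add: abs_mult)
      also have "\<bar>s\<bar> + \<bar>\<beta>\<bar> * snd y + \<bar>snd y\<bar> \<le> \<sigma> + (1 + \<bar>\<beta>\<bar>) * (2 * \<eta>)"
      proof -
        have "(1 + \<bar>\<beta>\<bar>) * snd y \<le> (1 + \<bar>\<beta>\<bar>) * (2 * \<eta>)" using y2 by (intro mult_left_mono) auto
        then show ?thesis using s y2 \<eta> by (simp add: algebra_simps)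
      qed
      also have "(1 + \<bar>\<beta>\<bar>) * (2 * \<eta>) = r / 2"
      proof -
        have "1 + \<bar>\<beta>\<bar> \<noteq> 0" by linarith
        then show ?thesis by (simp add: \<eta>_def field_simps)
      qed
      finally show ?thesis using \<sigma> by simp
    qed
    define p where "p = binary_form ?A y"
    define q where "q = binary_form B y"
    have p: "p = a * s\<^sup>2" by (simp add: p_def qA s_def)
    have p0: "0 \<le> p" using a by (simp add: p)
    have sp: "sqrt p = sqrt a * s" using s by (simp add: p real_sqrt_mult)
    have p\<mu>: "p \<le> \<mu> / 2"
    proof -
      have "s\<^sup>2 \<le> (sqrt (\<mu> / (2 * a)))\<^sup>2" using s \<sigma> by (intro power_mono) auto
      also have "\<dots> = \<mu> / (2 * a)" using \<mu> a by simp
      finally show ?thesis using a by (simp add: p field_simps)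
    qed
    have q\<mu>: "\<mu> \<le> q"
    proof -
      have "a0 * q = (a0 * fst y + b0 * snd y)\<^sup>2 + (a0 * d0 - b0\<^sup>2) * (snd y)\<^sup>2"
        by (simp add: q_def B_eq binary_form_def power2_eq_square algebra_simps)
      moreover have "(a0 * d0 - b0\<^sup>2) * \<eta>\<^sup>2 \<le> (a0 * d0 - b0\<^sup>2) * (snd y)\<^sup>2"
        using B0 y2 \<eta> by (intro mult_left_mono power_mono) auto
      moreover have "0 \<le> (a0 * fst y + b0 * snd y)\<^sup>2" by simp
      ultimately have "(a0 * d0 - b0\<^sup>2) * \<eta>\<^sup>2 \<le> a0 * q" by linarith
      then show ?thesis using B0 by (simp add: \<mu>_def field_simps)
    qed
    have p1: "p \<le> 1/2" and q1: "q \<le> 1/2" using r1(3)[of y] r2(3)[of y] ny r by (auto simp: p_def q_def)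
    have qC: "binary_form ?C y = (1 - t) * p + t * q" unfolding binary_form_linear p_def q_def ..
    have hC: "outer_height ?C y = sqrt ((1 - t) * p + t * q)"
    proof -
      have "(1 - t) * p + t * q \<le> (1 - t) * (1/2) + t * (1/2)"
        using t p1 q1 by (intro add_mono mult_left_mono) auto
      also have "\<dots> = 1/2" by argo
      also have "1/2 \<le> 1 - (norm y)\<^sup>2"
      proof -
        have "(norm y)\<^sup>2 \<le> (1/2)\<^sup>2" using ny r by (intro power_mono) auto
        then show ?thesis by (simp add: power2_eq_square)
      qed
      finally have "(1 - t) * p + t * q \<le> 1 - (norm y)\<^sup>2" .
      moreover have "0 \<le> (1 - t) * p + t * q" using t p0 q\<mu> \<mu> by simp
      ultimately show ?thesis unfolding outer_height_def qC by simp
    qed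
    have hA: "outer_height ?A y = sqrt p" using r1(2)[of y] ny r p0 by (simp add: p_def)
    have "t * (c / (k * s + \<tau>)) \<le> outer_height ?C y - outer_height ?A y"
      using sqrt_increment[OF p0 p\<mu> q\<mu>, of t] q1 t unfolding hC hA sp
      by (simp add: k_def c_def mult.assoc)
    moreover have "D y = c / (k * s + \<tau>)" using s y2 by (simp add: D_def \<phi>_def s_def)
    moreover have "0 \<le> t * outer_height ?A y" using t outer_height_nonneg by simp
    ultimately show ?thesis by simp
  qed

  define G where "G y = (outer_height ?C y - outer_height ?A y + t * outer_height ?A y) / t" for y
  have G_int: "integrable lborel G" unfolding G_def
    by (intro integrable_divide Bochner_Integration.integrable_add Bochner_Integration.integrable_diff
        integrable_mult_right integrable_outer_height)
  have DG: "D y \<le> G y" for y using key[of y] t by (simp add: G_def field_simps)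
  have D_meas: "D \<in> borel_measurable lborel"
  proof -
    have [measurable]: "fst \<in> borel_measurable (borel :: (real \<times> real) measure)"
        "snd \<in> borel_measurable (borel :: (real \<times> real) measure)"
      by (intro borel_measurable_continuous_onI continuous_intros)+
    show ?thesis unfolding D_def \<phi>_def measurable_lborel1 by measurable
  qed
  have D_int: "integrable lborel D"
    by (rule Bochner_Integration.integrable_bound[OF G_int D_meas])
       (use D_nonneg DG order_trans[OF DG abs_ge_self] in \<open>auto intro!: AE_I2\<close>)
  have "(\<integral>y. D y \<partial>lborel) = (2 * \<eta> - \<eta>) * (\<integral>s. \<phi> s \<partial>lborel)"
    unfolding D_def
    by (rule integral_sheared_strip[OF D_int[unfolded D_def[abs_def]]]) (use \<eta> in simp)
  also have "(\<integral>s. \<phi> s \<partial>lborel) = c / k * ln ((k * \<sigma> + \<tau>) / \<tau>)"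
    unfolding \<phi>_def by (rule integral_reciprocal) (use k \<tau> \<sigma> c in auto)
  finally have D_eq: "(\<integral>y. D y \<partial>lborel) = \<eta> * c / k * ln ((k * \<sigma> + \<tau>) / \<tau>)" by simp
  have "outer_volume ?A * k / (\<eta> * c) < ln ((k * \<sigma> + \<tau>) / \<tau>)"
  proof -
    have "exp (outer_volume ?A * k / (\<eta> * c)) \<le> k * \<sigma> / \<tau>"
      using \<tau> by (simp add: exp_minus field_simps)
    also have "\<dots> < (k * \<sigma> + \<tau>) / \<tau>" using \<tau> by (simp add: divide_strict_right_mono)
    finally have "ln (exp (outer_volume ?A * k / (\<eta> * c))) < ln ((k * \<sigma> + \<tau>) / \<tau>)"
      by (subst ln_less_cancel_iff) (use k \<sigma> \<tau> in \<open>auto intro!: add_pos_pos divide_pos_pos\<close>)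
    then show ?thesis by simp
  qed
  then have "\<eta> * c / k * (outer_volume ?A * k / (\<eta> * c)) < \<eta> * c / k * ln ((k * \<sigma> + \<tau>) / \<tau>)"
    using \<eta> c k by (intro mult_strict_left_mono) auto
  then have "outer_volume ?A < (\<integral>y. D y \<partial>lborel)" unfolding D_eq using \<eta> c k by simp
  also have "\<dots> \<le> (\<integral>y. G y \<partial>lborel)" by (rule integral_mono[OF D_int G_int DG])
  also have "\<dots> = (outer_volume ?C - outer_volume ?A + t * outer_volume ?A) / t"
    unfolding G_def outer_volume_def using integrable_outer_height by simp
  finally have "t * outer_volume ?A < outer_volume ?C - outer_volume ?A + t * outer_volume ?A"
    using t by (simp add: field_simps)
  then have "outer_volume ?A < outer_volume ?C" by simp
  with t show ?thesis by (intro that[of t])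
qed

text \<open>
  A nonzero degenerate semidefinite form has rank one, and exchanging the two coordinates, if
  necessary, makes its first coefficient positive. The zero form bounds no volume at all.
\<close>

lemma outer_volume_increases_from_degenerate:
  assumes A: "pos_semidef A" "\<not> pos_def A" and B: "pos_def B"
  obtains t where "0 < t" "t \<le> 1" "outer_volume A < outer_volume ((1 - t) *\<^sub>R A + t *\<^sub>R B)"
proof -
  obtain a b d where A_eq: "A = (a, b, d)" by (cases A) auto
  obtain a0 b0 d0 where B_eq: "B = (a0, b0, d0)" by (cases B) auto
  note pos_semidef = pos_semidefD[OF A(1)[unfolded A_eq]]
  have deg: "a * d = b\<^sup>2"
  proof (cases "a = 0")
    case True then show ?thesis using pos_semidef by simp
  next
    case False then show ?thesis using pos_semidef A(2) by (simp add: A_eq pos_def_iff)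
  qed
  consider "0 < a" | "0 < d" | "a = 0" "d = 0" using pos_semidef by linarith
  then show ?thesis
  proof cases
    case 1
    show ?thesis
      by (rule outer_volume_increases_from_rank_one[OF 1 deg B]) (use that in \<open>auto simp: A_eq\<close>)
  next
    case 2
    have B': "pos_def (d0, b0, a0)"
    proof -
      have *: "0 < a0" "b0\<^sup>2 < a0 * d0" using B by (auto simp: B_eq pos_def_iff)
      then have "0 < a0 * d0" using zero_le_power2[of b0] by linarith
      then have "0 < d0" using * by (simp add: zero_less_mult_iff)
      then show ?thesis using * by (simp add: pos_def_iff mult.commute)
    qed
    obtain t where t: "0 < t" "t \<le> 1"
        "outer_volume (d, b, a) < outer_volume ((1 - t) *\<^sub>R (d, b, a) + t *\<^sub>R (d0, b0, a0))"
      by (rule outer_volume_increases_from_rank_one[OF 2 _ B', of a b]) (use deg in \<open>auto simp: mult.commute\<close>)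
    then have "outer_volume A < outer_volume ((1 - t) *\<^sub>R A + t *\<^sub>R B)"
      by (simp add: A_eq B_eq outer_volume_swap[of d] outer_volume_swap[of "(1 - t) * d + t * d0"])
    with t show ?thesis by (intro that[of t])
  next
    case 3
    then have "A = 0" using deg by (simp add: A_eq zero_prod_def)
    have "outer_height A y = 0" for y by (simp add: outer_height_def \<open>A = 0\<close> max_absorb1)
    then have "outer_volume A = 0" by (simp add: outer_volume_def)
    then show ?thesis using outer_volume_pos[OF B] by (intro that[of 1]) auto
  qed
qed

section \<open>The form of maximal outer volume\<close>

text \<open>
  Maximize over the semidefinite forms that satisfy the constraints, which are a compact convex
  set. The maximum is definite, since moving from a degenerate form towards \<open>B\<close> increases the
  volume and stays in the set; it is unique because the midpoint of two maxima would be better.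
\<close>

lemma ex1_pos_def_of_maximal_outer_volume:
  fixes G :: "((real \<times> real) \<times> real) set"
  defines "feasible A \<equiv> pos_def A \<and> (\<forall>(y, z)\<in>G. binary_form A y \<le> z\<^sup>2)"
  assumes unit: "\<And>y z. (y, z) \<in> G \<Longrightarrow> z\<^sup>2 \<le> 1"
    and x: "x \<in> G" and y: "y \<in> G"
    and det: "fst (fst x) * snd (fst y) - snd (fst x) * fst (fst y) \<noteq> 0"
    and ex: "feasible B"
  shows "\<exists>!A. feasible A \<and> (\<forall>A'. feasible A' \<longrightarrow> outer_volume A' \<le> outer_volume A)"
proof -
  define S where "S = {A. pos_semidef A \<and> (\<forall>(y, z)\<in>G. binary_form A y \<le> z\<^sup>2)}"
  have S_comb: "u *\<^sub>R A + v *\<^sub>R A' \<in> S" if "A \<in> S" "A' \<in> S" "0 \<le> u" "0 \<le> v" "u + v = 1" for A A' u v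
  proof -
    have "binary_form (u *\<^sub>R A + v *\<^sub>R A') y \<le> z\<^sup>2" if "(y, z) \<in> G" for y z
    proof -
      have "u * binary_form A y + v * binary_form A' y \<le> u * z\<^sup>2 + v * z\<^sup>2"
        using \<open>A \<in> S\<close> \<open>A' \<in> S\<close> \<open>0 \<le> u\<close> \<open>0 \<le> v\<close> that
        by (intro add_mono mult_left_mono) (auto simp: S_def)
      also have "\<dots> = z\<^sup>2" using \<open>u + v = 1\<close> by (metis distrib_right mult_1)
      finally show ?thesis by (simp add: binary_form_linear)
    qed
    then show ?thesis using that by (auto simp: S_def intro!: pos_semidef_combination)
  qed
  have feasible_iff: "feasible A \<longleftrightarrow> A \<in> S \<and> pos_def A" for A
    using pos_def_imp_pos_semidef[of A] by (auto simp: feasible_def S_def)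
  have "compact S"
    unfolding compact_eq_bounded_closed
  proof
    show "bounded S" unfolding bounded_iff
    proof (intro exI ballI)
      fix A assume "A \<in> S"
      then have "pos_semidef A" "binary_form A (fst x) \<le> (snd x)\<^sup>2" "binary_form A (fst y) \<le> (snd y)\<^sup>2"
        using x y by (auto simp: S_def split_beta)
      moreover have "(snd x)\<^sup>2 \<le> 1" "(snd y)\<^sup>2 \<le> 1" using unit x y by (metis prod.collapse)+
      ultimately show "norm A \<le> 4 * (((norm (fst x))\<^sup>2 + (norm (fst y))\<^sup>2) /
          (fst (fst x) * snd (fst y) - snd (fst x) * fst (fst y))\<^sup>2)"
        using coefficients_bounded[OF _ det, of A] by simp
    qed
    have "S = (\<Inter>y. {A. 0 \<le> binary_form A y}) \<inter> (\<Inter>(y, z)\<in>G. {A. binary_form A y \<le> z\<^sup>2})"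
      by (auto simp: S_def pos_semidef_def)
    also have "closed \<dots>"
      by (intro closed_Int closed_INT ballI)
         (auto intro!: closed_Collect_le continuous_on_binary_form_left continuous_intros)
    finally show "closed S" .
  qed
  moreover have "S \<noteq> {}" using ex feasible_iff by blast
  ultimately obtain A where A: "A \<in> S" and max: "\<And>A'. A' \<in> S \<Longrightarrow> outer_volume A' \<le> outer_volume A"
    using continuous_attains_sup[OF _ _ continuous_on_outer_volume, of S] by blast
  have "pos_def A"
  proof (rule ccontr)
    assume "\<not> pos_def A"
    moreover have "pos_semidef A" using A by (simp add: S_def)
    moreover have B: "B \<in> S" "pos_def B" using ex feasible_iff by auto
    ultimately obtain t where t: "0 < t" "t \<le> 1" "outer_volume A < outer_volume ((1 - t) *\<^sub>R A + t *\<^sub>R B)"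
      using outer_volume_increases_from_degenerate[of A B] by blast
    moreover have "(1 - t) *\<^sub>R A + t *\<^sub>R B \<in> S" using A B t by (intro S_comb) auto
    ultimately show False using max leD by blast
  qed
  show ?thesis
  proof (rule ex1I[of _ A])
    show "feasible A \<and> (\<forall>A'. feasible A' \<longrightarrow> outer_volume A' \<le> outer_volume A)"
      using A \<open>pos_def A\<close> max feasible_iff by blast
    fix A' assume A': "feasible A' \<and> (\<forall>A''. feasible A'' \<longrightarrow> outer_volume A'' \<le> outer_volume A')"
    show "A' = A"
    proof (rule ccontr)
      assume "A' \<noteq> A"
      have A'S: "A' \<in> S" using A' feasible_iff by blast
      have eq: "outer_volume A' = outer_volume A"
        using A' max[OF A'S] A \<open>pos_def A\<close> feasible_iff by (metis order_antisym)
      have "(outer_volume A' + outer_volume A) / 2 < outer_volume ((1/2) *\<^sub>R A' + (1/2) *\<^sub>R A)"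
        using A A'S \<open>A' \<noteq> A\<close> by (intro outer_volume_strictly_concave) (auto simp: S_def)
      also have "\<dots> \<le> outer_volume A" using A A'S by (intro max S_comb) auto
      finally show False using eq by simp
    qed
  qed
qed

section \<open>Conics with a given center\<close>

lemma point_of_eq_iff:
  assumes "norm x = 1" "norm y = 1"
  shows "point_of x = point_of y \<longleftrightarrow> y = x \<or> y = - x"
  using Quotient3_rel[OF Quotient3_elliptic_plane, of x y] assms by auto

lemma quad_form_point_of: "norm x = 1 \<Longrightarrow> quad_form M (point_of x) = x \<bullet> (M *v x)"
  by (rule quad_form.abs_eq) simp

lemma elliptic_plane_cases:
  obtains x where "norm x = 1" "p = point_of x"
  using Quotient3_abs_rep[OF Quotient3_elliptic_plane, of p] Quotient3_rep_reflp[OF Quotient3_elliptic_plane, of p]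
  by metis

lemma form_scaleR:
  fixes M :: "real^3^3" and x :: "real^3"
  shows "(r *\<^sub>R x) \<bullet> (M *v (r *\<^sub>R x)) = r\<^sup>2 * (x \<bullet> (M *v x))"
  by (simp add: matrix_vector_mult_scaleR power2_eq_square)

text \<open>
  The zero set only records unit vectors; by homogeneity it determines the whole isotropic cone.
\<close>

lemma zero_set_eq_imp_isotropic:
  assumes "zero_set M = zero_set N" "x \<bullet> (M *v x) = 0"
  shows "x \<bullet> (N *v x) = 0"
proof (cases "x = 0")
  case False
  define u where "u = (1 / norm x) *\<^sub>R x"
  have u: "norm u = 1" using False by (simp add: u_def)
  have "u \<bullet> (M *v u) = 0" using assms(2) unfolding u_def form_scaleR by simp
  then have "point_of u \<in> zero_set M" using u by (simp add: zero_set_def quad_form_point_of)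
  then have "point_of u \<in> zero_set N" using assms(1) by simp
  then have "u \<bullet> (N *v u) = 0" using u by (simp add: zero_set_def quad_form_point_of)
  then show ?thesis using False unfolding u_def form_scaleR by simp
qed simp

text \<open>
  For orthogonal \<open>P\<close>, the point with the coordinates \<open>(y, z)\<close> in the orthonormal basis formed by
  the columns of \<open>P\<close>. The third column plays the role of the center.
\<close>

definition embed :: "real^3^3 \<Rightarrow> (real \<times> real) \<times> real \<Rightarrow> real^3" where
  "embed P w = P *v vector [fst (fst w), snd (fst w), snd w]"

text \<open>
  The matrix of the form \<open>q(y) - z\<^sup>2\<close>.
\<close>

definition block_matrix :: "real \<times> real \<times> real \<Rightarrow> real^3^3" where
  "block_matrix A = vector [vector [fst A, fst (snd A), 0],
     vector [fst (snd A), snd (snd A), 0], vector [0, 0, -1]]"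

definition central_matrix :: "real^3^3 \<Rightarrow> real \<times> real \<times> real \<Rightarrow> real^3^3" where
  "central_matrix P A = P ** block_matrix A ** transpose P"

lemma embed_surj:
  assumes "orthogonal_matrix P"
  obtains w where "x = embed P w"
proof -
  define v where "v = transpose P *v x"
  have "vector [v$1, v$2, v$3] = v" by (simp add: vec_eq_iff forall_3)
  moreover have "P *v v = x"
    using assms unfolding v_def matrix_vector_mul_assoc orthogonal_matrix_def by simp
  ultimately show ?thesis by (intro that[of "((v$1, v$2), v$3)"]) (simp add: embed_def)
qed

lemma orthogonal_matrix_inner:
  fixes P :: "real^'n^'n"
  assumes "orthogonal_matrix P"
  shows "(P *v x) \<bullet> (P *v y) = x \<bullet> y"
proof -
  have "orthogonal_transformation ((*v) P)"
    using assms by (simp add: orthogonal_transformation_matrix)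
  then show ?thesis by (simp add: orthogonal_transformation_def)
qed

lemma norm_embed:
  assumes "orthogonal_matrix P"
  shows "(norm (embed P w))\<^sup>2 = (norm (fst w))\<^sup>2 + (snd w)\<^sup>2"
proof -
  have "(norm (embed P w))\<^sup>2 = embed P w \<bullet> embed P w" by (simp add: power2_norm_eq_inner)
  also have "\<dots> = (fst (fst w))\<^sup>2 + (snd (fst w))\<^sup>2 + (snd w)\<^sup>2"
    unfolding embed_def orthogonal_matrix_inner[OF assms]
    by (simp add: inner_vec_def sum_3 power2_eq_square)
  finally show ?thesis by (simp add: norm_pair_sq)
qed

lemma symmetric_matrixD:
  assumes "transpose B = B" shows "B$i$j = B$j$i"
proof -
  have "B$i$j = transpose B$j$i" by (simp add: transpose_def)
  then show ?thesis by (simp only: assms)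
qed

lemma form_conjugate:
  fixes B :: "real^3^3"
  assumes "orthogonal_matrix P" "transpose B = B"
  shows "embed P ((y1, y2), z) \<bullet> ((P ** B ** transpose P) *v embed P ((y1, y2), z)) =
    B$1$1 * y1\<^sup>2 + 2 * B$1$2 * y1 * y2 + B$2$2 * y2\<^sup>2 + 2 * z * (B$1$3 * y1 + B$2$3 * y2) + B$3$3 * z\<^sup>2"
proof -
  let ?v = "vector [y1, y2, z] :: real^3"
  note sym = symmetric_matrixD[OF assms(2)]
  have "transpose P *v embed P ((y1, y2), z) = ?v"
    using assms by (simp add: embed_def matrix_vector_mul_assoc orthogonal_matrix_def)
  then have "(P ** B ** transpose P) *v embed P ((y1, y2), z) = P *v (B *v ?v)"
    by (simp only: matrix_vector_mul_assoc[symmetric])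
  then have "embed P ((y1, y2), z) \<bullet> ((P ** B ** transpose P) *v embed P ((y1, y2), z)) = ?v \<bullet> (B *v ?v)"
    by (simp add: embed_def orthogonal_matrix_inner[OF assms(1)])
  also have "\<dots> = B$1$1 * y1\<^sup>2 + 2 * B$1$2 * y1 * y2 + B$2$2 * y2\<^sup>2
      + 2 * z * (B$1$3 * y1 + B$2$3 * y2) + B$3$3 * z\<^sup>2"
    by (simp add: inner_vec_def sum_3 matrix_vector_mult_def sym[of 2 1] sym[of 3 1] sym[of 3 2]
        power2_eq_square algebra_simps)
  finally show ?thesis .
qed

lemma transpose_block_matrix: "transpose (block_matrix A) = block_matrix A"
  by (simp add: block_matrix_def transpose_def vec_eq_iff forall_3)

lemma transpose_central_matrix: "transpose (central_matrix P A) = central_matrix P A"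
  by (simp add: central_matrix_def matrix_transpose_mul transpose_block_matrix matrix_mul_assoc)

lemma form_central_matrix:
  assumes "orthogonal_matrix P"
  shows "embed P w \<bullet> (central_matrix P A *v embed P w) = binary_form A (fst w) - (snd w)\<^sup>2"
proof -
  obtain y1 y2 z where w: "w = ((y1, y2), z)" by (metis prod.collapse)
  show ?thesis
    unfolding w central_matrix_def form_conjugate[OF assms transpose_block_matrix]
    by (simp add: block_matrix_def binary_form_def)
qed

lemma matrix_mult_diff_left:
  fixes A B :: "real^'n^'m" and C :: "real^'k^'n"
  shows "(A - B) ** C = A ** C - B ** C"
  by (simp add: matrix_matrix_mult_def vec_eq_iff sum_subtractf algebra_simps)

lemma matrix_mult_diff_right:
  fixes A :: "real^'n^'m" and B C :: "real^'k^'n"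
  shows "A ** (B - C) = A ** B - A ** C"
  by (simp add: matrix_matrix_mult_def vec_eq_iff sum_subtractf algebra_simps)

lemma eigenvalues_conjugate:
  fixes B :: "real^3^3"
  assumes "orthogonal_matrix P"
  shows "has_eigenvalues (P ** B ** transpose P) a b c \<longleftrightarrow> has_eigenvalues B a b c"
proof -
  have "det (mat t - P ** B ** transpose P) = det (mat t - B)" for t
  proof -
    have "P ** mat t ** transpose P = t *\<^sub>R (P ** transpose P)"
    proof -
      have "mat t = t *\<^sub>R (mat 1 :: real^3^3)" by (simp add: mat_def vec_eq_iff)
      then show ?thesis by (simp add: matrix_scalar_ac scalar_matrix_assoc[symmetric])
    qed
    also have "\<dots> = mat t"
      using assms by (simp add: orthogonal_matrix_def mat_def vec_eq_iff)
    finally have "mat t - P ** B ** transpose P = P ** (mat t - B) ** transpose P"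
      by (simp add: matrix_mult_diff_left matrix_mult_diff_right)
    then have "det (mat t - P ** B ** transpose P) = det (P ** transpose P) * det (mat t - B)"
      by (simp add: det_mul)
    then show ?thesis using assms by (simp add: orthogonal_matrix_def)
  qed
  then show ?thesis by (simp add: has_eigenvalues_def)
qed

lemma eigenvalues_central_matrix:
  assumes "orthogonal_matrix P"
  shows "has_eigenvalues (central_matrix P (a, b, d)) u v w \<longleftrightarrow>
    (\<forall>t. ((t - a) * (t - d) - b\<^sup>2) * (t + 1) = (t - u) * (t - v) * (t - w))"
  unfolding central_matrix_def eigenvalues_conjugate[OF assms]
  unfolding has_eigenvalues_def
  by (simp add: block_matrix_def det_3 mat_def power2_eq_square algebra_simps)

text \<open>
  Splitting off the factor \<open>t + 1\<close> of the center leaves the characteristic polynomial of the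
  binary form, so \<open>a + d\<close> and \<open>a d - b\<^sup>2\<close> are the sum and the product of the two other
  eigenvalues. Both are positive if and only if the form is positive definite.
\<close>

lemma conic_central_matrix_iff:
  assumes P: "orthogonal_matrix P"
  shows "conic_matrix (central_matrix P A) \<longleftrightarrow> pos_def A"
proof -
  obtain a b d where A: "A = (a, b, d)" by (cases A) auto
  show ?thesis
  proof
    assume "conic_matrix (central_matrix P A)"
    then obtain u v where uv: "v \<le> u" "0 < v" "has_eigenvalues (central_matrix P A) u v (-1)"
      by (auto simp: conic_matrix_def)
    then have *: "((t - a) * (t - d) - b\<^sup>2) * (t + 1) = (t - u) * (t - v) * (t + 1)" for t
      by (simp add: A eigenvalues_central_matrix[OF P])
    have det: "a * d - b\<^sup>2 = u * v" using *[of 0] by simp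
    have tr: "a + d = u + v" using *[of 1] det by (simp add: algebra_simps)
    have "0 < a * d - b\<^sup>2" unfolding det using uv by simp
    then have ad: "b\<^sup>2 < a * d" by simp
    then have "0 < a * d" by (rule le_less_trans[OF zero_le_power2])
    then have "0 < a" using tr uv by (auto simp: zero_less_mult_iff)
    then show "pos_def A" using ad by (simp add: A pos_def_iff)
  next
    assume "pos_def A"
    then have a: "0 < a" and ad: "b\<^sup>2 < a * d" by (auto simp: A pos_def_iff)
    have "0 < a * d" using ad by (rule le_less_trans[OF zero_le_power2])
    then have d: "0 < d" using a by (simp add: zero_less_mult_iff)
    \<comment> \<open>The eigenvalues of the binary form are \<open>(a + d \<plusminus> D) / 2\<close>.\<close>
    define D where "D = sqrt ((a - d)\<^sup>2 + 4 * b\<^sup>2)"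
    have D: "D\<^sup>2 = (a - d)\<^sup>2 + 4 * b\<^sup>2" "0 \<le> D" by (simp_all add: D_def)
    have "D\<^sup>2 < (a + d)\<^sup>2" unfolding D using ad by (simp add: power2_eq_square algebra_simps)
    then have "D < a + d" by (rule power2_less_imp_less) (use a d in simp)
    have "has_eigenvalues (central_matrix P A) ((a + d + D) / 2) ((a + d - D) / 2) (-1)"
    proof -
      have "(t - (a + d + D) / 2) * (t - (a + d - D) / 2) = (t - a) * (t - d) - b\<^sup>2" for t
      proof -
        have "(t - (a + d + D) / 2) * (t - (a + d - D) / 2) = (t - (a + d) / 2)\<^sup>2 - D\<^sup>2 / 4"
          by (simp add: power2_eq_square field_simps)
        then show ?thesis unfolding D by (simp add: power2_eq_square field_simps)
      qed
      then show ?thesis by (simp add: A eigenvalues_central_matrix[OF P])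
    qed
    then show "conic_matrix (central_matrix P A)"
      unfolding conic_matrix_def
      using \<open>D < a + d\<close> D transpose_central_matrix
      by (intro conjI exI[of _ "(a + d + D) / 2"] exI[of _ "(a + d - D) / 2"]) auto
  qed
qed

lemma central_matrix_center:
  assumes "orthogonal_matrix P" "P *v axis 3 1 = c"
  shows "central_matrix P A *v c = - c"
proof -
  have "transpose P *v c = axis 3 1"
    using assms by (simp add: matrix_vector_mul_assoc orthogonal_matrix_def flip: assms(2))
  then have "central_matrix P A *v c = P *v (block_matrix A *v axis 3 1)"
    by (simp add: central_matrix_def matrix_vector_mul_assoc[symmetric])
  also have "block_matrix A *v axis 3 1 = - axis 3 1"
    by (simp add: block_matrix_def vec_eq_iff forall_3 matrix_vector_mult_def sum_3 axis_def)
  finally show ?thesis using assms(2) by (simp add: linear_neg[OF matrix_vector_mul_linear])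
qed

text \<open>
  In the basis given by \<open>P\<close> the center is the third unit vector. That it is an eigenvector for \<open>-1\<close>
  fixes the third column, and by symmetry the third row.
\<close>

lemma central_matrix_exists:
  assumes P: "orthogonal_matrix P" "P *v axis 3 1 = c" and M: "transpose M = M" "M *v c = - c"
  obtains A where "M = central_matrix P A"
proof -
  define B where "B = transpose P ** M ** P"
  have PP: "transpose P ** P = mat 1" "P ** transpose P = mat 1" using P by (auto simp: orthogonal_matrix_def)
  have M_eq: "M = P ** B ** transpose P"
    by (metis B_def PP(2) matrix_mul_assoc matrix_mul_lid matrix_mul_rid)
  have B_sym: "transpose B = B"
    by (simp add: B_def matrix_transpose_mul transpose_transpose M matrix_mul_assoc)
  have "B *v axis 3 1 = transpose P *v (M *v c)"
    by (simp add: B_def matrix_vector_mul_assoc[symmetric] P)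
  also have "\<dots> = - (transpose P *v (P *v axis 3 1))"
    by (simp add: M P linear_neg[OF matrix_vector_mul_linear])
  also have "\<dots> = - axis 3 1" by (simp add: matrix_vector_mul_assoc PP)
  finally have e3: "B *v axis 3 1 = - axis 3 1" .
  have "B$i$3 = (- axis 3 1 :: real^3)$i" for i
    unfolding e3[symmetric] by (simp add: matrix_vector_mult_def sum_3 axis_def)
  then have col: "B$1$3 = 0" "B$2$3 = 0" "B$3$3 = -1" by (simp_all add: axis_def)
  note sym = symmetric_matrixD[OF B_sym]
  have B_eq: "block_matrix (B$1$1, B$1$2, B$2$2) = B"
    by (simp add: block_matrix_def vec_eq_iff forall_3 col sym[of 2 1] sym[of 3 1] sym[of 3 2])
  have "M = central_matrix P (B$1$1, B$1$2, B$2$2)"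
    unfolding M_eq central_matrix_def B_eq ..
  then show ?thesis by (rule that)
qed

text \<open>
  The conic \<open>q(y) = z\<^sup>2\<close> contains \<open>(y, z)\<close> and \<open>(y, -z)\<close> for every \<open>y\<close>. If a second form
  vanishes on it, then comparing the two signs kills the mixed terms in \<open>y\<close> and \<open>z\<close>, and what
  is left says that the second form is a multiple of \<open>q(y) - z\<^sup>2\<close>. The factor is \<open>1\<close> because
  both matrices have the signature \<open>(2, 1)\<close> and the negative eigenvalue \<open>-1\<close>.
\<close>

lemma conic_matrix_determined:
  assumes P: "orthogonal_matrix P" and A: "pos_def A" and M: "conic_matrix M"
    and eq: "zero_set M = zero_set (central_matrix P A)"
  shows "M = central_matrix P A"
proof -
  obtain a b d where A_eq: "A = (a, b, d)" by (cases A) auto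
  have a: "0 < a" and ad: "b\<^sup>2 < a * d" using A by (auto simp: A_eq pos_def_iff)
  have "0 < a * d" using ad by (rule le_less_trans[OF zero_le_power2])
  then have d: "0 < d" using a by (simp add: zero_less_mult_iff)
  define B where "B = transpose P ** M ** P"
  have PP: "transpose P ** P = mat 1" "P ** transpose P = mat 1" using P by (auto simp: orthogonal_matrix_def)
  have M_eq: "M = P ** B ** transpose P"
    by (metis B_def PP(2) matrix_mul_assoc matrix_mul_lid matrix_mul_rid)
  have "transpose M = M" using M by (simp add: conic_matrix_def)
  then have B_sym: "transpose B = B"
    by (simp add: B_def matrix_transpose_mul transpose_transpose matrix_mul_assoc)
  note sym = symmetric_matrixD[OF B_sym]
  have zero: "B$1$1 * y1\<^sup>2 + 2 * B$1$2 * y1 * y2 + B$2$2 * y2\<^sup>2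
      + 2 * z * (B$1$3 * y1 + B$2$3 * y2) + B$3$3 * z\<^sup>2 = 0" if "binary_form A (y1, y2) = z\<^sup>2" for y1 y2 z
  proof -
    have "embed P ((y1, y2), z) \<bullet> (central_matrix P A *v embed P ((y1, y2), z)) = 0"
      using that by (simp add: form_central_matrix[OF P])
    then have "embed P ((y1, y2), z) \<bullet> (M *v embed P ((y1, y2), z)) = 0"
      by (rule zero_set_eq_imp_isotropic[OF eq[symmetric]])
    then show ?thesis unfolding M_eq form_conjugate[OF P B_sym] .
  qed
  \<comment> \<open>The factor \<open>\<rho>\<close> is read off the coefficient of \<open>z\<^sup>2\<close>. The values of the form at \<open>y = (1, 0)\<close>,
    \<open>(0, 1)\<close> and \<open>(1, 1)\<close> give the other coefficients.\<close>
  define \<rho> where "\<rho> = - B$3$3"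
  have "B$1$1 + 2 * (sqrt a * B$1$3) + B$3$3 * a = 0" "B$1$1 - 2 * (sqrt a * B$1$3) + B$3$3 * a = 0"
    using zero[of 1 0 "sqrt a"] zero[of 1 0 "- sqrt a"] a by (simp_all add: A_eq binary_form_def mult.assoc)
  then have "sqrt a * B$1$3 = 0" and B11: "B$1$1 = \<rho> * a"
    unfolding \<rho>_def mult_minus_left by linarith+
  then have B13: "B$1$3 = 0" using a by simp
  have "B$2$2 + 2 * (sqrt d * B$2$3) + B$3$3 * d = 0" "B$2$2 - 2 * (sqrt d * B$2$3) + B$3$3 * d = 0"
    using zero[of 0 1 "sqrt d"] zero[of 0 1 "- sqrt d"] d by (simp_all add: A_eq binary_form_def mult.assoc)
  then have "sqrt d * B$2$3 = 0" and B22: "B$2$2 = \<rho> * d"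
    unfolding \<rho>_def mult_minus_left by linarith+
  then have B23: "B$2$3 = 0" using d by simp
  have "0 \<le> binary_form A (1, 1)" using pos_def_imp_pos_semidef[OF A] unfolding pos_semidef_def by blast
  then have "\<rho> * a + 2 * B$1$2 + \<rho> * d = \<rho> * binary_form A (1, 1)"
    using zero[of 1 1 "sqrt (binary_form A (1, 1))"] by (simp add: B11 B13 B22 B23) (simp add: \<rho>_def)
  then have "B$1$2 = \<rho> * b" by (simp add: A_eq binary_form_def algebra_simps)
  note B = this B11 B13 B22 B23
  have B_eq: "B = vector [vector [\<rho> * a, \<rho> * b, 0], vector [\<rho> * b, \<rho> * d, 0], vector [0, 0, - \<rho>]]"
    by (simp add: vec_eq_iff forall_3 B sym[of 2 1] sym[of 3 1] sym[of 3 2]) (simp add: \<rho>_def)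
  obtain u v where uv: "v \<le> u" "0 < v" "has_eigenvalues B u v (-1)"
    using M by (auto simp: conic_matrix_def M_eq eigenvalues_conjugate[OF P])
  have char: "((t - \<rho> * a) * (t - \<rho> * d) - (\<rho> * b)\<^sup>2) * (t + \<rho>) = (t - u) * (t - v) * (t + 1)" for t
  proof -
    have "det (mat t - B) = ((t - \<rho> * a) * (t - \<rho> * d) - (\<rho> * b)\<^sup>2) * (t + \<rho>)"
      by (simp add: B_eq det_3 mat_def power2_eq_square algebra_simps)
    moreover have "det (mat t - B) = (t - u) * (t - v) * (t + 1)"
      using uv(3) by (simp add: has_eigenvalues_def)
    ultimately show ?thesis by simp
  qed
  \<comment> \<open>The determinant shows \<open>\<rho> > 0\<close>; as \<open>-\<rho>\<close> is an eigenvalue, it is then the negative one.\<close>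
  have "u * v = \<rho> ^ 3 * (a * d - b\<^sup>2)"
    using char[of 0] by (simp add: power2_eq_square power3_eq_cube algebra_simps)
  moreover have "0 < u * v" using uv by simp
  ultimately have "0 < \<rho> ^ 3 * (a * d - b\<^sup>2)" by argo
  then have "0 < \<rho> ^ 3" using ad by (simp add: zero_less_mult_iff)
  then have "0 < \<rho>" by (simp add: zero_less_power_eq)
  moreover have "(- \<rho> - u) * (- \<rho> - v) * (- \<rho> + 1) = 0" using char[of "- \<rho>"] by simp
  ultimately have "\<rho> = 1" using uv by auto
  then show ?thesis unfolding M_eq central_matrix_def B_eq A_eq by (simp add: block_matrix_def)
qed

text \<open>
  This eliminates the quantifiers over matrices from the notions that are defined for conics as
  point sets.
\<close>

lemma conic_matrix_of_zero_set_iff: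
  assumes "orthogonal_matrix P" "pos_def A"
  shows "conic_matrix M \<and> zero_set (central_matrix P A) = zero_set M \<longleftrightarrow> M = central_matrix P A"
proof
  assume "conic_matrix M \<and> zero_set (central_matrix P A) = zero_set M"
  then show "M = central_matrix P A" by (intro conic_matrix_determined[OF assms]) simp_all
next
  assume "M = central_matrix P A"
  then show "conic_matrix M \<and> zero_set (central_matrix P A) = zero_set M"
    using conic_central_matrix_iff[OF assms(1), of A] assms(2) by simp
qed

lemma conic_interior_central:
  assumes "orthogonal_matrix P" "pos_def A"
  shows "conic_interior (zero_set (central_matrix P A)) = {p. quad_form (central_matrix P A) p < 0}"
  unfolding conic_interior_def conj_assoc[symmetric] conic_matrix_of_zero_set_iff[OF assms] by simp

lemma encloses_central:
  assumes "orthogonal_matrix P" "pos_def A"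
  shows "encloses (zero_set (central_matrix P A)) F \<longleftrightarrow> (\<forall>p\<in>F. quad_form (central_matrix P A) p \<le> 0)"
  unfolding encloses_def conj_assoc[symmetric] conic_matrix_of_zero_set_iff[OF assms] by simp

section \<open>The area of a central conic\<close>

lemma lborel_coordinates:
  "(lborel :: ((real \<times> real) \<times> real) measure) = distr lborel borel (\<lambda>v::real^3. ((v$1, v$2), v$3))"
proof (rule lborel_eqI)
  fix l u :: "(real \<times> real) \<times> real"
  assume le: "\<And>b. b \<in> Basis \<Longrightarrow> l \<bullet> b \<le> u \<bullet> b"
  obtain l1 l2 l3 u1 u2 u3 where lu: "l = ((l1, l2), l3)" "u = ((u1, u2), u3)"
    by (metis prod.collapse)
  have le': "l1 \<le> u1" "l2 \<le> u2" "l3 \<le> u3"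
    using le[of "((1, 0), 0)"] le[of "((0, 1), 0)"] le[of "((0, 0), 1)"]
    by (auto simp: lu Basis_prod_def zero_prod_def)
  let ?l = "vector [l1, l2, l3] :: real^3" and ?u = "vector [u1, u2, u3] :: real^3"
  have "emeasure (distr lborel borel (\<lambda>v::real^3. ((v$1, v$2), v$3))) (box l u)
      = emeasure lborel ((\<lambda>v::real^3. ((v$1, v$2), v$3)) -` box l u)"
    by (subst emeasure_distr) (auto intro!: borel_measurable_Pair borel_measurable_nth)
  also have "(\<lambda>v::real^3. ((v$1, v$2), v$3)) -` box l u = box ?l ?u"
    by (auto simp: lu mem_box_cart forall_3 mem_box Basis_prod_def)
  also have "emeasure lborel (box ?l ?u) = (\<Prod>b\<in>Basis. (?u - ?l) \<bullet> b)"
  proof (rule emeasure_lborel_box)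
    have "?l $ i \<le> ?u $ i" for i using exhaust_3[of i] le' by auto
    then show "?l \<bullet> b \<le> ?u \<bullet> b" if "b \<in> Basis" for b
      using that by (auto simp: Basis_vec_def inner_axis)
  qed
  also have "(\<Prod>b\<in>Basis. (?u - ?l) \<bullet> b) = (\<Prod>i\<in>UNIV. (?u - ?l) $ i)"
  proof -
    have Basis_eq: "(Basis :: (real^3) set) = range (\<lambda>i. axis i 1)" by (auto simp: Basis_vec_def)
    have inj: "inj (\<lambda>i. axis i 1 :: real^3)" by (auto simp: inj_def axis_eq_axis)
    have "(\<Prod>b\<in>Basis. (?u - ?l) \<bullet> b) = (\<Prod>i\<in>UNIV. (?u - ?l) \<bullet> axis i 1)"
      unfolding Basis_eq prod.reindex[OF inj] o_def ..
    then show ?thesis by (simp add: inner_axis)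
  qed
  also have "\<dots> = (u1 - l1) * (u2 - l2) * (u3 - l3)"
    unfolding UNIV_3 by simp
  also have "\<dots> = (\<Prod>b\<in>Basis. (u - l) \<bullet> b)"
    by (simp add: lu Basis_prod_def prod.union_disjoint)
  finally show "emeasure (distr lborel borel (\<lambda>v::real^3. ((v$1, v$2), v$3))) (box l u)
      = ennreal (\<Prod>b\<in>Basis. (u - l) \<bullet> b)" .
qed simp

lemma measure_embed:
  assumes P: "orthogonal_matrix P" and S: "S \<in> sets borel" "emeasure lborel S < \<infinity>"
  shows "measure lebesgue (embed P ` S) = measure lborel S"
proof -
  let ?\<kappa> = "\<lambda>v::real^3. ((v$1, v$2), v$3)"
  let ?T = "?\<kappa> -` S"
  have \<kappa>: "?\<kappa> \<in> borel_measurable borel"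
    by (intro borel_measurable_Pair borel_measurable_nth)
  have T: "?T \<in> sets borel" using measurable_sets[OF \<kappa> S(1)] by simp
  have em: "emeasure lborel S = emeasure lborel ?T"
    using \<kappa> S by (subst lborel_coordinates, subst emeasure_distr) auto
  have Tl: "?T \<in> lmeasurable"
    using T S(2) em by (intro fmeasurableI) auto
  have img: "embed P ` S = (\<lambda>v. P *v v) ` ?T"
  proof (intro set_eqI iffI)
    fix x assume "x \<in> embed P ` S"
    then obtain w where "w \<in> S" "x = embed P w" by auto
    then show "x \<in> (\<lambda>v. P *v v) ` ?T"
      by (intro image_eqI[of _ _ "vector [fst (fst w), snd (fst w), snd w]"]) (auto simp: embed_def)
  next
    fix x assume "x \<in> (\<lambda>v. P *v v) ` ?T"
    then obtain v where v: "?\<kappa> v \<in> S" "x = P *v v" by auto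
    have "vector [v$1, v$2, v$3] = v" by (simp add: vec_eq_iff forall_3)
    then show "x \<in> embed P ` S" using v by (intro image_eqI[of _ _ "?\<kappa> v"]) (auto simp: embed_def)
  qed
  have orth: "orthogonal_transformation (\<lambda>v. P *v v)"
    using P by (simp add: orthogonal_transformation_matrix)
  have "measure lebesgue (embed P ` S) = measure lebesgue ?T"
    unfolding img by (rule measure_orthogonal_image[OF orth Tl])
  also have "\<dots> = measure lborel ?T" using T by (simp add: measure_completion)
  also have "\<dots> = measure lborel S" by (simp add: measure_def em)
  finally show "measure lebesgue (embed P ` S) = measure lborel S" .
qed

lemma length_square_le: "emeasure lborel {z::real. z\<^sup>2 \<le> h} = ennreal (2 * sqrt (max 0 h))"
proof (cases "0 \<le> h")
  case True
  have "{z::real. z\<^sup>2 \<le> h} = {- sqrt h..sqrt h}"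
  proof -
    have *: "z\<^sup>2 \<le> h \<longleftrightarrow> \<bar>z\<bar> \<le> sqrt h" for z by (metis real_sqrt_abs real_sqrt_le_iff)
    have "{z::real. z\<^sup>2 \<le> h} = {z. \<bar>z\<bar> \<le> sqrt h}" by (simp only: *)
    also have "\<dots> = {- sqrt h..sqrt h}" by (auto simp: abs_le_iff)
    finally show ?thesis .
  qed
  then show ?thesis using True by simp
next
  case False
  then have "{z::real. z\<^sup>2 \<le> h} = {}" using order_trans[OF zero_le_power2] by blast
  then show ?thesis using False by simp
qed

lemma measure_outer_region:
  "emeasure lborel {w. (norm (fst w))\<^sup>2 + (snd w)\<^sup>2 \<le> 1 \<and> (snd w)\<^sup>2 \<le> binary_form A (fst w)}
    = ennreal (2 * outer_volume A)"
proof -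
  let ?D = "{w :: (real \<times> real) \<times> real. (norm (fst w))\<^sup>2 + (snd w)\<^sup>2 \<le> 1 \<and> (snd w)\<^sup>2 \<le> binary_form A (fst w)}"
  have "closed ?D"
    by (intro closed_Collect_conj closed_Collect_le continuous_intros)
       (simp add: binary_form_def, intro continuous_intros)
  then have D: "?D \<in> sets (lborel \<Otimes>\<^sub>M lborel)" unfolding lborel_prod by simp
  have slice: "Pair y -` ?D = {z. z\<^sup>2 \<le> min (binary_form A y) (1 - (norm y)\<^sup>2)}" for y
    by auto
  have "emeasure lborel ?D = emeasure (lborel \<Otimes>\<^sub>M lborel) ?D" by (simp add: lborel_prod)
  also have "\<dots> = (\<integral>\<^sup>+y. emeasure lborel (Pair y -` ?D) \<partial>lborel)"
    by (rule lborel.emeasure_pair_measure_alt[OF D])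
  also have "\<dots> = (\<integral>\<^sup>+y. ennreal (2 * outer_height A y) \<partial>lborel)"
    by (simp only: slice length_square_le outer_height_def)
  also have "\<dots> = ennreal (\<integral>y. 2 * outer_height A y \<partial>lborel)"
    by (intro nn_integral_eq_integral integrable_mult_right integrable_outer_height)
       (auto simp: outer_height_nonneg)
  finally show ?thesis by (simp add: outer_volume_def)
qed

lemma embed_zero: "embed P 0 = 0"
proof -
  have "vector [0, 0, 0] = (0 :: real^3)" by (simp add: vec_eq_iff forall_3)
  then show ?thesis by (simp add: embed_def)
qed

text \<open>
  The cone over the interior of the conic is, up to the apex, the unit ball without the region of
  \<open>measure_outer_region\<close>. With the normalizing factor \<open>3 / 2\<close> the ball contributes
  \<open>(3/2) (4/3) \<pi> = 2 \<pi>\<close> and the removed region \<open>(3/2) 2 outer_volume\<close>.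
\<close>

lemma conic_area_central:
  assumes P: "orthogonal_matrix P" and A: "pos_def A"
  shows "conic_area (zero_set (central_matrix P A)) = 2 * pi - 3 * outer_volume A"
proof -
  let ?N = "central_matrix P A"
  let ?W = "{w :: (real \<times> real) \<times> real. (norm (fst w))\<^sup>2 + (snd w)\<^sup>2 \<le> 1}"
  let ?D = "{w :: (real \<times> real) \<times> real. (norm (fst w))\<^sup>2 + (snd w)\<^sup>2 \<le> 1 \<and> (snd w)\<^sup>2 \<le> binary_form A (fst w)}"
  have W: "?W = cball 0 1"
    by (simp add: set_eq_iff norm_prod_def)
  have "closed ?D"
    by (intro closed_Collect_conj closed_Collect_le continuous_intros)
       (simp add: binary_form_def, intro continuous_intros)
  then have D_borel: "?D \<in> sets borel" by simp
  have "?D \<subseteq> ?W" by auto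
  have W_fin: "emeasure lborel ?W < \<infinity>" unfolding W using emeasure_lborel_cball_finite[of 0 1] by auto
  have mW: "measure lborel ?W = 4 / 3 * pi"
    unfolding W using content_cball[of 1 "0 :: (real \<times> real) \<times> real"] by (simp add: unit_ball_vol_3)
  have mD: "measure lborel ?D = 2 * outer_volume A"
    using measure_outer_region[of A] outer_volume_nonneg[of A] by (simp add: measure_def)
  have cone: "{r *\<^sub>R x | r x. 0 \<le> r \<and> r \<le> 1 \<and> x \<in> sphere_preimage (conic_interior (zero_set ?N))}
      = embed P ` (insert 0 (?W - ?D))"
  proof (intro set_eqI iffI)
    fix v assume "v \<in> {r *\<^sub>R x | r x. 0 \<le> r \<and> r \<le> 1 \<and> x \<in> sphere_preimage (conic_interior (zero_set ?N))}"
    then obtain r x where rx: "v = r *\<^sub>R x" "0 \<le> r" "r \<le> 1" "norm x = 1" "x \<bullet> (?N *v x) < 0"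
      by (auto simp: sphere_preimage_def conic_interior_central[OF P A] quad_form_point_of)
    obtain w where w: "v = embed P w" using embed_surj[OF P] by blast
    show "v \<in> embed P ` (insert 0 (?W - ?D))"
    proof (cases "r = 0")
      case True
      then show ?thesis using rx by (intro image_eqI[of _ _ 0]) (auto simp: embed_zero)
    next
      case False
      have "binary_form A (fst w) - (snd w)\<^sup>2 = v \<bullet> (?N *v v)" by (simp add: w form_central_matrix[OF P])
      also have "\<dots> < 0" unfolding rx(1) form_scaleR using rx False by (simp add: mult_pos_neg)
      finally have "binary_form A (fst w) < (snd w)\<^sup>2" by simp
      moreover have "(norm (fst w))\<^sup>2 + (snd w)\<^sup>2 \<le> 1"
        using rx by (simp add: norm_embed[OF P, symmetric] w[symmetric] power_le_one)
      ultimately show ?thesis using w by auto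
    qed
  next
    fix v assume "v \<in> embed P ` (insert 0 (?W - ?D))"
    then obtain w where w: "v = embed P w" "w = 0 \<or> w \<in> ?W - ?D" by blast
    \<comment> \<open>The apex lies on the segment to every interior point; take the one on the \<open>z\<close>-axis.\<close>
    define w' where "w' = (if w = 0 then ((0, 0), 1) else w)"
    define x where "x = (1 / norm (embed P w')) *\<^sub>R embed P w'"
    have neg: "binary_form A (fst w') < (snd w')\<^sup>2" using w by (auto simp: w'_def binary_form_def)
    have "embed P w' \<noteq> 0"
    proof
      assume "embed P w' = 0"
      then have "binary_form A (fst w') - (snd w')\<^sup>2 = 0" using form_central_matrix[OF P, of w' A] by simp
      then show False using neg by simp
    qed
    then have x: "norm x = 1" "x \<bullet> (?N *v x) < 0"
      using neg unfolding x_def form_scaleR form_central_matrix[OF P]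
      by (simp_all add: mult_pos_neg)
    have "v = norm v *\<^sub>R x"
    proof (cases "w = 0")
      case True
      then have "v = 0" by (simp add: w embed_zero)
      then show ?thesis by simp
    next
      case False
      then show ?thesis using \<open>embed P w' \<noteq> 0\<close> by (simp add: x_def w'_def w)
    qed
    moreover have "norm v \<le> 1"
    proof -
      have "(norm v)\<^sup>2 \<le> 1" using w by (auto simp: norm_embed[OF P])
      then show ?thesis by (simp add: power_le_one_iff abs_square_le_1)
    qed
    ultimately show "v \<in> {r *\<^sub>R x | r x. 0 \<le> r \<and> r \<le> 1 \<and> x \<in> sphere_preimage (conic_interior (zero_set ?N))}"
      using x by (auto simp: sphere_preimage_def conic_interior_central[OF P A] quad_form_point_of intro!: exI[of _ "norm v"] exI[of _ x])
  qed
  have fin: "emeasure lborel (insert 0 (?W - ?D)) < \<infinity>"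
  proof -
    have "emeasure lborel (insert 0 (?W - ?D)) \<le> emeasure lborel ?W"
      by (intro emeasure_mono) (auto simp: W)
    then show ?thesis using W_fin by (rule le_less_trans)
  qed
  have "measure lebesgue (embed P ` (insert 0 (?W - ?D))) = measure lborel (insert 0 (?W - ?D))"
    by (rule measure_embed[OF P _ fin]) (use D_borel in \<open>auto simp: W\<close>)
  also have "\<dots> = measure lborel (?W - ?D)"
  proof -
    have "emeasure lborel (insert 0 (?W - ?D)) = emeasure lborel ((?W - ?D) \<union> {0})" by simp
    also have "\<dots> = emeasure lborel (?W - ?D)"
      using D_borel by (intro emeasure_Un_null_set) (auto simp: W)
    finally show ?thesis by (simp add: measure_def)
  qed
  also have "\<dots> = measure lborel ?W - measure lborel ?D"
    using W_fin D_borel \<open>?D \<subseteq> ?W\<close> by (intro measure_Diff) (auto simp: W)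
  finally show ?thesis
    unfolding conic_area_def elliptic_area_def sphere_area_def cone mW mD by simp
qed

section \<open>Existence and uniqueness of the minimal conic\<close>

text \<open>
  A line is the image of a plane through the origin, that is, of the orthogonal complement of a
  nonzero vector \<open>n\<close>.
\<close>

lemma full_dimensionalD:
  assumes "full_dimensional F" "n \<noteq> 0"
  obtains x where "norm x = 1" "point_of x \<in> F" "n \<bullet> x \<noteq> 0"
proof (rule ccontr)
  assume "\<not> thesis"
  with that have *: "n \<bullet> x = 0" if "norm x = 1" "point_of x \<in> F" for x
    using \<open>norm x = 1\<close> \<open>point_of x \<in> F\<close> by blast
  let ?V = "{x. n \<bullet> x = 0}"
  have "is_line (point_of ` (?V \<inter> sphere 0 1))"
    unfolding is_line_def using dim_hyperplane[OF assms(2)] subspace_hyperplane by (intro exI[of _ ?V]) auto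
  moreover have "F \<subseteq> point_of ` (?V \<inter> sphere 0 1)"
  proof
    fix p assume "p \<in> F"
    obtain x where "norm x = 1" "p = point_of x" by (rule elliptic_plane_cases)
    then show "p \<in> point_of ` (?V \<inter> sphere 0 1)" using * \<open>p \<in> F\<close> by auto
  qed
  ultimately show False using assms(1) unfolding full_dimensional_def by blast
qed

text \<open>
  Minimizing the area over conics is maximizing the outer volume over forms. Two points of \<open>F\<close>
  with independent \<open>y\<close> are found by applying \<open>full_dimensionalD\<close> twice, with vectors orthogonal
  to the center: the second one is orthogonal to the first point as well.
\<close>

theorem theorem5:
  fixes F :: "elliptic_plane set" and p :: elliptic_plane
  assumes "elliptic_bounded F"
    and "compact F"
    and "full_dimensional F"
    and "\<exists>C. is_conic C \<and> is_center p C \<and> encloses C F"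
  shows "\<exists>!C. is_arg_min conic_area (\<lambda>C. is_conic C \<and> is_center p C \<and> encloses C F) C"
proof -
  obtain c where c: "norm c = 1" "p = point_of c"
    by (rule elliptic_plane_cases)
  obtain P where P: "orthogonal_matrix P" "P *v axis 3 1 = c"
    using orthogonal_matrix_exists_basis[OF c(1), of 3] by blast
  let ?C = "\<lambda>A. zero_set (central_matrix P A)"
  define G where "G = {w. norm (embed P w) = 1 \<and> point_of (embed P w) \<in> F}"
  define feasible where "feasible A \<longleftrightarrow> pos_def A \<and> (\<forall>(y, z)\<in>G. binary_form A y \<le> z\<^sup>2)" for A
  have encl: "encloses (?C A) F \<longleftrightarrow> feasible A" if "pos_def A" for A
  proof -
    have "(\<forall>p\<in>F. quad_form (central_matrix P A) p \<le> 0) \<longleftrightarrow> (\<forall>(y, z)\<in>G. binary_form A y \<le> z\<^sup>2)"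
    proof safe
      fix y1 y2 z assume *: "\<forall>p\<in>F. quad_form (central_matrix P A) p \<le> 0" and "((y1, y2), z) \<in> G"
      then have "quad_form (central_matrix P A) (point_of (embed P ((y1, y2), z))) \<le> 0"
        by (auto simp: G_def)
      then show "binary_form A (y1, y2) \<le> z\<^sup>2" using \<open>((y1, y2), z) \<in> G\<close>
        by (simp add: quad_form_point_of G_def form_central_matrix[OF P(1)])
    next
      fix q assume *: "\<forall>(y, z)\<in>G. binary_form A y \<le> z\<^sup>2" and "q \<in> F"
      obtain x where x: "norm x = 1" "q = point_of x" by (rule elliptic_plane_cases)
      obtain w where w: "x = embed P w" using embed_surj[OF P(1)] by blast
      have "w \<in> G" using x w \<open>q \<in> F\<close> by (simp add: G_def)
      then have "binary_form A (fst w) \<le> (snd w)\<^sup>2" using * by (auto simp: split_beta)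
      then show "quad_form (central_matrix P A) q \<le> 0"
        using x by (simp add: quad_form_point_of w form_central_matrix[OF P(1)])
    qed
    then show ?thesis using that by (simp add: encloses_central[OF P(1)] feasible_def)
  qed
  have admissible: "is_conic C \<and> is_center p C \<and> encloses C F \<longleftrightarrow> (\<exists>A. feasible A \<and> C = ?C A)" for C
  proof
    assume C: "is_conic C \<and> is_center p C \<and> encloses C F"
    then obtain M x where M: "conic_matrix M" "C = zero_set M" "norm x = 1" "M *v x = - x" "p = point_of x"
      by (auto simp: is_center_def)
    \<comment> \<open>A point of the plane fixes its representative only up to sign.\<close>
    then have "c = x \<or> c = - x" using c point_of_eq_iff by metis
    then have "M *v c = - c" using M(4) by (auto simp: linear_neg[OF matrix_vector_mul_linear])
    then obtain A where A: "M = central_matrix P A"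
      using central_matrix_exists[OF P, of M] M(1) unfolding conic_matrix_def by blast
    then have "pos_def A" using M(1) conic_central_matrix_iff[OF P(1)] by simp
    then show "\<exists>A. feasible A \<and> C = ?C A" using C M(2) A encl by blast
  next
    assume "\<exists>A. feasible A \<and> C = ?C A"
    then obtain A where A: "feasible A" "C = ?C A" by blast
    then have "pos_def A" by (simp add: feasible_def)
    then have "conic_matrix (central_matrix P A)" using conic_central_matrix_iff[OF P(1)] by simp
    then show "is_conic C \<and> is_center p C \<and> encloses C F"
      using A encl[OF \<open>pos_def A\<close>] c central_matrix_center[OF P, of A]
      unfolding is_conic_def is_center_def by blast
  qed
  have area: "conic_area (?C A) = 2 * pi - 3 * outer_volume A" if "feasible A" for A
    using that by (intro conic_area_central[OF P(1)]) (simp add: feasible_def)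
  have "\<exists>!A. feasible A \<and> (\<forall>A'. feasible A' \<longrightarrow> outer_volume A' \<le> outer_volume A)"
  proof -
    \<comment> \<open>Not all of \<open>F\<close> is on the line through the center with the normal vector \<open>(k1, k2, 0)\<close>.\<close>
    have ex_off: "\<exists>w\<in>G. k1 * fst (fst w) + k2 * snd (fst w) \<noteq> 0" if "(k1, k2) \<noteq> (0, 0)" for k1 k2
    proof -
      have "norm (embed P ((k1, k2), 0)) \<noteq> 0"
      proof
        assume "norm (embed P ((k1, k2), 0)) = 0"
        then show False using norm_embed[OF P(1), of "((k1, k2), 0)"] that by (simp add: zero_prod_def)
      qed
      then have "embed P ((k1, k2), 0) \<noteq> 0" by simp
      then obtain x where x: "norm x = 1" "point_of x \<in> F" "embed P ((k1, k2), 0) \<bullet> x \<noteq> 0"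
        by (rule full_dimensionalD[OF assms(3)])
      obtain w where w: "x = embed P w" using embed_surj[OF P(1)] by blast
      have "embed P ((k1, k2), 0) \<bullet> x = k1 * fst (fst w) + k2 * snd (fst w)"
        unfolding w embed_def orthogonal_matrix_inner[OF P(1)] by (simp add: inner_vec_def sum_3)
      then show ?thesis using x w by (intro bexI[of _ w]) (auto simp: G_def)
    qed
    obtain x where x: "x \<in> G" "fst (fst x) \<noteq> 0" using ex_off[of 1 0] by auto
    obtain y where y: "y \<in> G" "- snd (fst x) * fst (fst y) + fst (fst x) * snd (fst y) \<noteq> 0"
      using ex_off[of "- snd (fst x)" "fst (fst x)"] x by auto
    obtain B where "feasible B" using assms(4) admissible by blast
    show ?thesis unfolding feasible_def
    proof (rule ex1_pos_def_of_maximal_outer_volume[OF _ x(1) y(1)])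
      show "z\<^sup>2 \<le> 1" if "(y, z) \<in> G" for y z
        using that norm_embed[OF P(1), of "(y, z)"] by (simp add: G_def) (metis le_add_same_cancel2 zero_le_power2)
      show "fst (fst x) * snd (fst y) - snd (fst x) * fst (fst y) \<noteq> 0" using y(2) by (simp add: algebra_simps)
      show "pos_def B \<and> (\<forall>(y, z)\<in>G. binary_form B y \<le> z\<^sup>2)" using \<open>feasible B\<close> by (simp add: feasible_def)
    qed
  qed
  then obtain A where A: "feasible A" "\<And>A'. feasible A' \<Longrightarrow> outer_volume A' \<le> outer_volume A"
    and unique: "\<And>B. feasible B \<Longrightarrow> (\<And>A'. feasible A' \<Longrightarrow> outer_volume A' \<le> outer_volume B) \<Longrightarrow> B = A"
    by (elim ex1E) blast
  show ?thesis
  proof (rule ex1I[of _ "?C A"])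
    show "is_arg_min conic_area (\<lambda>C. is_conic C \<and> is_center p C \<and> encloses C F) (?C A)"
      unfolding is_arg_min_def admissible
    proof (intro conjI notI)
      show "\<exists>A'. feasible A' \<and> ?C A = ?C A'" using A(1) by blast
      assume "\<exists>C. (\<exists>A'. feasible A' \<and> C = ?C A') \<and> conic_area C < conic_area (?C A)"
      then obtain A' where A': "feasible A'" "conic_area (?C A') < conic_area (?C A)" by blast
      then show False using A(2)[OF A'(1)] area[OF A'(1)] area[OF A(1)] by linarith
    qed
    fix C assume "is_arg_min conic_area (\<lambda>C. is_conic C \<and> is_center p C \<and> encloses C F) C"
    then obtain B where B: "feasible B" "C = ?C B" and min: "\<And>A'. feasible A' \<Longrightarrow> \<not> conic_area (?C A') < conic_area (?C B)"
      unfolding is_arg_min_def admissible by blast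
    have "B = A"
    proof (rule unique[OF B(1)])
      fix A' assume "feasible A'"
      then show "outer_volume A' \<le> outer_volume B" using min[of A'] B(1) area by simp
    qed
    then show "C = ?C A" using B(2) by simp
  qed
qed

end
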